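(* Let $(G,\varphi)$ be a group with parity. The groups $\{G\wr\Sigma_{n+1}\}_{n\ge0}$ together with the set maps $\underline g^*\colon\Delta([m],[n])\to\Delta([m],[n])$ (for $\underline g\in G\wr\Sigma_{n+1}$) and $\phi^*\colon G\wr\Sigma_{n+1}\to G\wr\Sigma_{m+1}$ (for $\phi\in\Delta([m],[n])$) given by the twisted symmetric construction define a crossed simplicial group $\Delta\varphi\wr\mathbf\Sigma$.
   Context: \textbf{Group with parity.} A group $G$ with a homomorphism $\varphi\colon G\to C_2=\{1,-1\}$. \textbf{Crossed simplicial group.} A small category $\Delta\mathbf G$ with objects $[n]$, $n\ge0$, containing the simplex category $\Delta$ as a wide subcategory, with $\mathrm{Aut}([n])=G_n^{\mathrm{op}}$ for groups $G_n$, such that each morphism $[n]\to[m]$ factors uniquely as $\phi\circ g$ with $\phi\in\Delta([n],[m])$, $g\in G_n^{\mathrm{op}}$. Writing $g\circ\phi=(g^*\phi)\circ(\phi^*g)$ for $g\in G_m$, $\phi\in\Delta([n],[m])$ yields set maps $g^*\colon\Delta([n],[m])\to\Delta([n],[m])$, $\phi^*\colon G_m\to G_n$. Conversely, groups $G_n$ with set maps $g^*,\phi^*$ define a crossed simplicial group precisely if the following identities hold (for all composable $\phi,\psi$ and all group elements): $(\phi\circ\psi)^*(g)=\psi^*(\phi^*g)$; $\mathrm{id}^*g=g$, $\phi^*(e)=e$; $(gh)^*\phi=h^*(g^*\phi)$; $e^*\phi=\phi$, $g^*\mathrm{id}=\mathrm{id}$; $g^*(\phi\circ\psi)=g^*\phi\circ(\phi^*g)^*\psi$;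 $\phi^*(gh)=\phi^*g\cdot(g^*\phi)^*h$. \textbf{Symmetric case.} For $\gamma\in\Sigma_{n+1}$ (permutations of $[n]=\{0,\dots,n\}$) and $\phi\in\Delta([m],[n])$, $\gamma^*\phi\in\Delta([m],[n])$ and $\phi^*\gamma\in\Sigma_{m+1}$ are the unique maps with $\gamma\circ\gamma^*\phi=\phi\circ\phi^*\gamma$ as maps of sets such that $\phi^*\gamma$ is order preserving on each preimage $(\gamma^*\phi)^{-1}(j)$. These define the symmetric crossed simplicial group. \textbf{Twisted symmetric construction.} Multiplication in $G\wr\Sigma_{n+1}$: $(g_0,\dots,g_n;\gamma)(g_0',\dots,g_n';\gamma')=(g_0g'_{\gamma^{-1}(0)},\dots,g_ng'_{\gamma^{-1}(n)};\gamma\gamma')$. For $\phi\colon[m]\to[n]$ in $\Delta$ set: $(g_0,\dots,g_n;\gamma)^*\phi=\gamma^*\phi$; $\phi^*(e,\dots,e;\gamma)=(e,\dots,e;\phi^*\gamma)$; on generators of $\Delta$ ($\delta_i$ skips $i$, $\sigma_i$ repeats $i$), $\delta_i^*(g_0,\dots,g_n;\mathrm{id})=(g_0,\dots,g_{i-1},g_{i+1},\dots,g_n;\mathrm{id})$ and $\sigma_i^*(g_0,\dots,g_n;\mathrm{id})=(g_0,\dots,g_i,g_i,\dots,g_n;\tau)$ with $\tau=\mathrm{id}$ if $\varphi(g_i)=1$ and $\tau$ the transposition $(i,i+1)$ if $\varphi(g_i)=-1$, extended by $(\phi\circ\psi)^*=\psi^*\circ\phi^*$. Thus $\phi^*(g_0,\dots,g_n;\mathrm{id})$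 repeats each $g_i$ $|\phi^{-1}(i)|$ times, with the permutation preserving each block $\phi^{-1}(i)$, being the identity on it if $g_i$ is even and reversing it if $g_i$ is odd. Finally $\phi^*(g_0,\dots,g_n;\gamma)=\phi^*(g_0,\dots,g_n;\mathrm{id})\cdot\phi^*(e,\dots,e;\gamma)$. *)

theory Defs
  imports "HOL-Library.FuncSet" "HOL-Combinatorics.Permutations" "HOL-Algebra.Sym_Groups"
begin

section \<open>Categories with objects $[n]$, and the simplex category\<close>

text \<open>The natural number \<open>n\<close> stands for the object $[n]$. Hom-sets are indexed by source and target
  and need not be disjoint; hence composition carries the indices as well:
  \<open>cmp C l m n f g\<close> is $f \circ g$ for $f : [m] \to [n]$ and $g : [l] \to [m]$.\<close>

record 'm ncat =
  mor :: "nat \<Rightarrow> nat \<Rightarrow> 'm set"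
  cmp :: "nat \<Rightarrow> nat \<Rightarrow> nat \<Rightarrow> 'm \<Rightarrow> 'm \<Rightarrow> 'm"
  idt :: "nat \<Rightarrow> 'm"

locale ncategory =
  fixes C :: "'m ncat"
  assumes idt_mor: "idt C n \<in> mor C n n"
    and cmp_mor: "f \<in> mor C m n \<Longrightarrow> g \<in> mor C l m \<Longrightarrow> cmp C l m n f g \<in> mor C l n"
    and cmp_idt_left: "f \<in> mor C m n \<Longrightarrow> cmp C m n n (idt C n) f = f"
    and cmp_idt_right: "f \<in> mor C m n \<Longrightarrow> cmp C m m n f (idt C m) = f"
    and cmp_assoc: "f \<in> mor C m n \<Longrightarrow> g \<in> mor C l m \<Longrightarrow> h \<in> mor C k l \<Longrightarrow>
      cmp C k l n (cmp C l m n f g) h = cmp C k m n f (cmp C k l m g h)"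

definition aut_group :: "'m ncat \<Rightarrow> nat \<Rightarrow> 'm monoid" where
  "aut_group C n =
    \<lparr>carrier = {f \<in> mor C n n. \<exists>f' \<in> mor C n n.
        cmp C n n n f f' = idt C n \<and> cmp C n n n f' f = idt C n},
     mult = cmp C n n n, one = idt C n\<rparr>"

definition opposite_group :: "'g monoid \<Rightarrow> 'g monoid" where
  "opposite_group G = \<lparr>carrier = carrier G, mult = (\<lambda>x y. y \<otimes>\<^bsub>G\<^esub> x), one = \<one>\<^bsub>G\<^esub>\<rparr>"

text \<open>Morphisms are extensional (\<open>undefined\<close> outside $\{0,\dots,m\}$), so that equality of functions
  is equality of maps $[m] \to [n]$.\<close>

definition simplex_mor :: "nat \<Rightarrow> nat \<Rightarrow> (nat \<Rightarrow> nat) set" where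
  "simplex_mor m n = {f \<in> {..m} \<rightarrow>\<^sub>E {..n}. mono_on {..m} f}"

definition simplex_cat :: "(nat \<Rightarrow> nat) ncat" where
  "simplex_cat = \<lparr>mor = simplex_mor, cmp = (\<lambda>l m n f g. compose {..l} f g), idt = (\<lambda>n. \<lambda>i\<in>{..n}. i)\<rparr>"

definition face :: "nat \<Rightarrow> nat \<Rightarrow> nat \<Rightarrow> nat" where
  "face n i = (\<lambda>j\<in>{..n}. if j < i then j else Suc j)"

definition degen :: "nat \<Rightarrow> nat \<Rightarrow> nat \<Rightarrow> nat" where
  "degen n i = (\<lambda>j\<in>{..Suc n}. if j \<le> i then j else j - 1)"


section \<open>Crossed simplicial groups\<close>

text \<open>The wide subcategory is presented as an identity-on-objects, faithful functor \<open>\<iota>\<close> out of the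
  simplex category, and the identification of automorphism groups with $G_n^{\mathrm{op}}$ as a
  family of group isomorphisms \<open>\<theta>\<close>.\<close>

locale crossed_simplicial_group = ncategory C
  for C :: "'m ncat" +
  fixes G :: "nat \<Rightarrow> 'g monoid"
    and \<iota> :: "nat \<Rightarrow> nat \<Rightarrow> (nat \<Rightarrow> nat) \<Rightarrow> 'm"
    and \<theta> :: "nat \<Rightarrow> 'g \<Rightarrow> 'm"
  assumes group_G: "group (G n)"
    and \<iota>_mor: "\<phi> \<in> mor simplex_cat m n \<Longrightarrow> \<iota> m n \<phi> \<in> mor C m n"
    and \<iota>_idt: "\<iota> n n (idt simplex_cat n) = idt C n"
    and \<iota>_cmp: "\<phi> \<in> mor simplex_cat m n \<Longrightarrow> \<psi> \<in> mor simplex_cat l m \<Longrightarrow>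
      \<iota> l n (cmp simplex_cat l m n \<phi> \<psi>) = cmp C l m n (\<iota> m n \<phi>) (\<iota> l m \<psi>)"
    and \<iota>_inj: "inj_on (\<iota> m n) (mor simplex_cat m n)"
    and \<theta>_iso: "\<theta> n \<in> iso (opposite_group (G n)) (aut_group C n)"
    and unique_factorization: "f \<in> mor C m n \<Longrightarrow>
      \<exists>!p. p \<in> mor simplex_cat m n \<times> carrier (G m) \<and>
           f = cmp C m m n (\<iota> m n (fst p)) (\<theta> m (snd p))"

text \<open>Groups \<open>G n\<close> with set maps \<open>act m n g\<close> $= g^*$ on $\Delta([m],[n])$ and
  \<open>pull m n \<phi>\<close> $= \phi^* : G_n \to G_m$ define a crossed simplicial group if there is one with these
  groups in which $g \circ \phi = (g^*\phi) \circ (\phi^* g)$; by unique factorization, the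
  given maps are then the ones that it induces. Fixing the type of morphisms is no restriction, since
  unique factorization identifies the morphisms $[m] \to [n]$ with pairs in
  $\Delta([m],[n]) \times G_m$.\<close>

definition defines_crossed_simplicial_group ::
  "(nat \<Rightarrow> 'g monoid) \<Rightarrow> (nat \<Rightarrow> nat \<Rightarrow> 'g \<Rightarrow> (nat \<Rightarrow> nat) \<Rightarrow> (nat \<Rightarrow> nat)) \<Rightarrow>
    (nat \<Rightarrow> nat \<Rightarrow> (nat \<Rightarrow> nat) \<Rightarrow> 'g \<Rightarrow> 'g) \<Rightarrow> bool" where
  "defines_crossed_simplicial_group G act pull \<longleftrightarrow>
    (\<exists>(C :: ((nat \<Rightarrow> nat) \<times> 'g) ncat) \<iota> \<theta>.
      crossed_simplicial_group C G \<iota> \<theta> \<and>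
      (\<forall>m n. \<forall>g \<in> carrier (G n). \<forall>\<phi> \<in> mor simplex_cat m n.
        act m n g \<phi> \<in> mor simplex_cat m n \<and>
        pull m n \<phi> g \<in> carrier (G m) \<and>
        cmp C m n n (\<theta> n g) (\<iota> m n \<phi>) =
          cmp C m m n (\<iota> m n (act m n g \<phi>)) (\<theta> m (pull m n \<phi> g))))"


section \<open>The symmetric crossed simplicial group\<close>

definition sym_pair ::
  "nat \<Rightarrow> nat \<Rightarrow> (nat \<Rightarrow> nat) \<Rightarrow> (nat \<Rightarrow> nat) \<Rightarrow> (nat \<Rightarrow> nat) \<times> (nat \<Rightarrow> nat)" where
  "sym_pair m n \<gamma> \<phi> = (THE (\<psi>, \<beta>).
     \<psi> \<in> mor simplex_cat m n \<and> \<beta> permutes {..m} \<and>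
     (\<forall>i \<le> m. \<gamma> (\<psi> i) = \<phi> (\<beta> i)) \<and>
     (\<forall>j \<le> n. mono_on {i \<in> {..m}. \<psi> i = j} \<beta>))"

definition sym_act :: "nat \<Rightarrow> nat \<Rightarrow> (nat \<Rightarrow> nat) \<Rightarrow> (nat \<Rightarrow> nat) \<Rightarrow> (nat \<Rightarrow> nat)" where
  "sym_act m n \<gamma> \<phi> = fst (sym_pair m n \<gamma> \<phi>)"

definition sym_pull :: "nat \<Rightarrow> nat \<Rightarrow> (nat \<Rightarrow> nat) \<Rightarrow> (nat \<Rightarrow> nat) \<Rightarrow> (nat \<Rightarrow> nat)" where
  "sym_pull m n \<phi> \<gamma> = snd (sym_pair m n \<gamma> \<phi>)"


section \<open>The twisted symmetric construction\<close>

text \<open>\<open>sign_img\<close> is the group $C_2 = \{1,-1\}$.\<close>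

locale group_with_parity = group G
  for G :: "'a monoid" (structure) +
  fixes par :: "'a \<Rightarrow> int"
  assumes par_hom: "par \<in> hom G sign_img"

text \<open>\<open>wreath G n\<close> is $G \wr \Sigma_{n+1}$.\<close>

definition unit_tuple :: "'a monoid \<Rightarrow> nat \<Rightarrow> nat \<Rightarrow> 'a" where
  "unit_tuple G n = (\<lambda>i\<in>{..n}. \<one>\<^bsub>G\<^esub>)"

definition wreath :: "'a monoid \<Rightarrow> nat \<Rightarrow> ((nat \<Rightarrow> 'a) \<times> (nat \<Rightarrow> nat)) monoid" where
  "wreath G n =
    \<lparr>carrier = ({..n} \<rightarrow>\<^sub>E carrier G) \<times> {\<gamma>. \<gamma> permutes {..n}},
     mult = (\<lambda>(g, \<gamma>) (g', \<gamma>'). (\<lambda>i\<in>{..n}. g i \<otimes>\<^bsub>G\<^esub> g' (inv_into UNIV \<gamma> i), \<gamma> \<circ> \<gamma>')),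
     one = (unit_tuple G n, id)\<rparr>"

definition twisted_act ::
  "nat \<Rightarrow> nat \<Rightarrow> (nat \<Rightarrow> 'a) \<times> (nat \<Rightarrow> nat) \<Rightarrow> (nat \<Rightarrow> nat) \<Rightarrow> (nat \<Rightarrow> nat)" where
  "twisted_act m n x \<phi> = sym_act m n (snd x) \<phi>"

text \<open>The construction prescribes $\phi^*$ on $(g_0,\dots,g_n;\mathrm{id})$ for generators of the simplex
  category only and extends contravariantly to all $\phi$, so it is a system of
  conditions on the family \<open>P m n \<phi>\<close> $= \phi^* : G \wr \Sigma_{n+1} \to G \wr \Sigma_{m+1}$, for
  $\phi : [m] \to [n]$, rather than an explicit definition. Existence and
  uniqueness of such a family are not built in. Contravariance is required only on the elements $(g_0,\dots,g_n;\mathrm{id})$.\<close>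

definition twisted_symmetric_construction ::
  "'a monoid \<Rightarrow> ('a \<Rightarrow> int) \<Rightarrow>
    (nat \<Rightarrow> nat \<Rightarrow> (nat \<Rightarrow> nat) \<Rightarrow> (nat \<Rightarrow> 'a) \<times> (nat \<Rightarrow> nat) \<Rightarrow> (nat \<Rightarrow> 'a) \<times> (nat \<Rightarrow> nat)) \<Rightarrow> bool"
  where
  "twisted_symmetric_construction G par P \<longleftrightarrow>
    (\<forall>m n. \<forall>\<phi> \<in> mor simplex_cat m n. P m n \<phi> \<in> carrier (wreath G n) \<rightarrow> carrier (wreath G m)) \<and>
    (\<forall>m n \<gamma>. \<forall>\<phi> \<in> mor simplex_cat m n. \<gamma> permutes {..n} \<longrightarrow>
       P m n \<phi> (unit_tuple G n, \<gamma>) = (unit_tuple G m, sym_pull m n \<phi> \<gamma>)) \<and>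
    (\<forall>n. \<forall>i \<le> Suc n. \<forall>g \<in> {..Suc n} \<rightarrow>\<^sub>E carrier G.
       P n (Suc n) (face n i) (g, id) = ((\<lambda>k\<in>{..n}. if k < i then g k else g (Suc k)), id)) \<and>
    (\<forall>n. \<forall>i \<le> n. \<forall>g \<in> {..n} \<rightarrow>\<^sub>E carrier G.
       P (Suc n) n (degen n i) (g, id) =
         ((\<lambda>k\<in>{..Suc n}. if k \<le> i then g k else g (k - 1)),
          if par (g i) = 1 then id else transpose i (Suc i))) \<and>
    (\<forall>l m n. \<forall>\<phi> \<in> mor simplex_cat m n. \<forall>\<psi> \<in> mor simplex_cat l m. \<forall>g \<in> {..n} \<rightarrow>\<^sub>E carrier G.
       P l n (cmp simplex_cat l m n \<phi> \<psi>) (g, id) = P l m \<psi> (P m n \<phi> (g, id))) \<and>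
    (\<forall>m n \<gamma>. \<forall>\<phi> \<in> mor simplex_cat m n. \<forall>g \<in> {..n} \<rightarrow>\<^sub>E carrier G. \<gamma> permutes {..n} \<longrightarrow>
       P m n \<phi> (g, \<gamma>) = P m n \<phi> (g, id) \<otimes>\<^bsub>wreath G m\<^esub> P m n \<phi> (unit_tuple G n, \<gamma>))"

end

theory Submission
  imports Defs
begin

text \<open>Since reversing fibres of \<open>\<phi>\<close> does not change \<open>\<phi>\<close>, the permutation part \<open>\<alpha>\<close> of
  \<open>\<phi>\<^sup>*(g\<^sub>0,\<dots>,g\<^sub>n;\<gamma>)\<close> together with \<open>\<psi> = \<gamma>\<^sup>*\<phi>\<close> still satisfies \<open>\<gamma> \<circ> \<psi> = \<phi> \<circ> \<alpha>\<close>,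
  and the pair \<open>(\<psi>, \<alpha>)\<close> is characterised among all such pairs by \<open>\<alpha>\<close> being
  increasing on \<open>\<psi>\<^sup>-\<^sup>1(j)\<close> if \<open>g\<^bsub>\<gamma>(j)\<^esub>\<close> is even and decreasing if it is odd. Every identity of a
  crossed simplicial group follows by verifying this characterisation for the composite in question.
  Since the simplex category is generated by faces and degeneracies, the values on generators
  determine the maps \<open>\<phi>\<^sup>*\<close>.\<close>

section \<open>Monotone maps\<close>

text \<open>Ranking the keys gives a permutation whose inverse sorts. Conversely, a sorting
  \<open>\<alpha>\<close> puts the element of rank \<open>i\<close> at position \<open>i\<close>, so
  it is that inverse. Injectivity of the key excludes ties.\<close>

lemma ex1_sorting_permutation:
  fixes key :: "nat \<Rightarrow> nat"
  assumes inj: "inj_on key {..m}"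
  shows "\<exists>!\<alpha>. \<alpha> permutes {..m} \<and> strict_mono_on {..m} (key \<circ> \<alpha>)"
proof -
  \<comment> \<open>\<open>r\<close> counts the smaller keys; beyond \<open>m\<close> it is the
    identity, as \<open>permutes\<close> demands.\<close>
  define r where "r i = (if i \<le> m then card {k \<in> {..m}. key k < key i} else i)" for i
  have r_less: "r i < r j" if "i \<le> m" "j \<le> m" "key i < key j" for i j
  proof -
    have "{k \<in> {..m}. key k < key i} \<subset> {k \<in> {..m}. key k < key j}"
      using that by auto
    then have "card {k \<in> {..m}. key k < key i} < card {k \<in> {..m}. key k < key j}"
      by (intro psubset_card_mono) auto
    then show ?thesis using that by (simp add: r_def)
  qed
  have r_inj: "inj_on r {..m}"
  proof (rule inj_onI)
    fix i j assume "i \<in> {..m}" "j \<in> {..m}" "r i = r j"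
    then have "key i = key j"
      using r_less[of i j] r_less[of j i] by (cases "key i" "key j" rule: linorder_cases) auto
    then show "i = j" using inj \<open>i \<in> {..m}\<close> \<open>j \<in> {..m}\<close> by (auto dest: inj_onD)
  qed
  have "r i \<le> m" if "i \<le> m" for i
  proof -
    have "{k \<in> {..m}. key k < key i} \<subset> {..m}" using that by auto
    then have "card {k \<in> {..m}. key k < key i} < card {..m}" by (intro psubset_card_mono) auto
    then show ?thesis using that by (simp add: r_def)
  qed
  then have "r ` {..m} = {..m}" by (intro endo_inj_surj r_inj) auto
  then have "bij_betw r {..m} {..m}" using r_inj by (simp add: bij_betw_def)
  then have r_perm: "r permutes {..m}" by (rule bij_imp_permutes) (auto simp: r_def)
  show ?thesis
  proof (intro ex1I[of _ "inv' r"] conjI)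
    show inv_perm: "inv' r permutes {..m}" using r_perm by (rule permutes_inv)
    show "strict_mono_on {..m} (key \<circ> inv' r)"
    proof (rule strict_mono_onI)
      fix a b assume ab: "a \<in> {..m}" "b \<in> {..m}" "a < b"
      have le: "inv' r a \<le> m" "inv' r b \<le> m"
        using permutes_in_image[OF inv_perm, of a] permutes_in_image[OF inv_perm, of b] ab by auto
      have "r (inv' r a) = a" "r (inv' r b) = b"
        using r_perm by (simp_all add: permutes_inverses)
      then have "\<not> key (inv' r b) < key (inv' r a)" "inv' r a \<noteq> inv' r b"
        using r_less[OF le(2,1)] ab by auto
      moreover have "key (inv' r a) \<noteq> key (inv' r b)"
        using inj le calculation(2) by (auto dest: inj_onD)
      ultimately show "(key \<circ> inv' r) a < (key \<circ> inv' r) b" by auto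
    qed
  next
    fix \<alpha> assume "\<alpha> permutes {..m} \<and> strict_mono_on {..m} (key \<circ> \<alpha>)"
    then have perm: "\<alpha> permutes {..m}" and mono: "strict_mono_on {..m} (key \<circ> \<alpha>)" by auto
    have "r (\<alpha> i) = i" for i
    proof (cases "i \<le> m")
      case True
      \<comment> \<open>The keys below that of \<open>\<alpha> i\<close> sit exactly at the
        positions before \<open>i\<close>, so \<open>\<alpha> i\<close> has rank
        \<open>i\<close>.\<close>
      have "{k \<in> {..m}. key k < key (\<alpha> i)} = \<alpha> ` {..<i}"
      proof (intro Set.set_eqI iffI)
        fix k assume k: "k \<in> {k \<in> {..m}. key k < key (\<alpha> i)}"
        then obtain a where a: "a \<le> m" "k = \<alpha> a"
          using permutes_image[OF perm] by (metis (lifting) atMost_iff imageE mem_Collect_eq)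
        have "a < i"
        proof (rule ccontr)
          assume "\<not> a < i"
          then have "(key \<circ> \<alpha>) i \<le> (key \<circ> \<alpha>) a"
            using mono True a strict_mono_onD[OF mono, of i a] by (cases "a = i") auto
          then show False using k a by simp
        qed
        then show "k \<in> \<alpha> ` {..<i}" using a by auto
      next
        fix k assume "k \<in> \<alpha> ` {..<i}"
        then obtain a where a: "a < i" "k = \<alpha> a" by auto
        then have "key k < key (\<alpha> i)" using strict_mono_onD[OF mono, of a i] True by auto
        moreover have "k \<le> m" using permutes_in_image[OF perm, of a] a True by auto
        ultimately show "k \<in> {k \<in> {..m}. key k < key (\<alpha> i)}" by auto
      qed
      moreover have "card (\<alpha> ` {..<i}) = i"
        using permutes_inj_on[OF perm] by (subst card_image) auto
      moreover have "\<alpha> i \<le> m" using permutes_in_image[OF perm, of i] True by auto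
      ultimately show ?thesis by (simp add: r_def)
    next
      case False
      then have "\<alpha> i = i" using perm by (simp add: permutes_not_in)
      then show ?thesis using False by (simp add: r_def)
    qed
    then show "\<alpha> = inv' r"
      using permutes_inverses(2)[OF r_perm] by (metis ext)
  qed
qed

text \<open>In base \<open>Suc m\<close>, numbers with last digit at most \<open>m\<close> compare
  lexicographically; two sorting criteria thus fit into one natural number.\<close>

lemma mixed_radix_less_iff:
  fixes x y u v m :: nat
  assumes "u \<le> m" "v \<le> m"
  shows "x * Suc m + u < y * Suc m + v \<longleftrightarrow> x < y \<or> x = y \<and> u < v"
proof -
  have *: "a * Suc m + c < b * Suc m + d" if "a < b" "c \<le> m" for a b c d :: nat
  proof -
    have "Suc a * Suc m \<le> b * Suc m" using that by (intro mult_right_mono) auto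
    then show ?thesis using that by simp
  qed
  show ?thesis using *[of x y u v] *[of y x v u] assms
    by (cases x y rule: linorder_cases) (auto simp del: mult_Suc_right)
qed

section \<open>Morphisms of the simplex category\<close>

lemma simplex_morI:
  assumes "\<phi> \<in> extensional {..m}" "\<And>i. i \<le> m \<Longrightarrow> \<phi> i \<le> n"
    and "\<And>i j. i \<le> j \<Longrightarrow> j \<le> m \<Longrightarrow> \<phi> i \<le> \<phi> j"
  shows "\<phi> \<in> simplex_mor m n"
  using assms by (simp add: simplex_mor_def PiE_iff monotone_on_def)

lemma simplex_mor_le: "\<phi> \<in> simplex_mor m n \<Longrightarrow> i \<le> m \<Longrightarrow> \<phi> i \<le> n"
  by (auto simp: simplex_mor_def)

lemma simplex_mor_mono: "\<phi> \<in> simplex_mor m n \<Longrightarrow> i \<le> j \<Longrightarrow> j \<le> m \<Longrightarrow> \<phi> i \<le> \<phi> j"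
  by (simp add: simplex_mor_def monotone_on_def)

lemma simplex_mor_cancel: "\<phi> \<in> simplex_mor m n \<Longrightarrow> \<phi> i < \<phi> j \<Longrightarrow> i \<le> m \<Longrightarrow> i < j"
  by (meson leD leI simplex_mor_mono)

lemma simplex_mor_eqI:
  assumes "\<phi> \<in> simplex_mor m n" "\<psi> \<in> simplex_mor m k" "\<And>i. i \<le> m \<Longrightarrow> \<phi> i = \<psi> i"
  shows "\<phi> = \<psi>"
proof -
  have "\<phi> \<in> extensional {..m}" "\<psi> \<in> extensional {..m}"
    using assms(1,2) by (auto simp: simplex_mor_def PiE_def)
  then show ?thesis using assms(3) by (auto intro: extensionalityI)
qed

lemma simplex_mor_compose:
  "\<phi> \<in> simplex_mor m n \<Longrightarrow> \<psi> \<in> simplex_mor l m \<Longrightarrow> compose {..l} \<phi> \<psi> \<in> simplex_mor l n"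
  unfolding simplex_mor_def by (auto simp: compose_def monotone_on_def PiE_iff)

lemma simplex_mor_id: "(\<lambda>i\<in>{..n}. i) \<in> simplex_mor n n"
  by (auto simp: simplex_mor_def monotone_on_def)

text \<open>A monotone map is determined by the multiset of its values. If
  \<open>\<psi> i < \<phi> i\<close>, then \<open>\<pi>\<close> would inject \<open>{..i}\<close>
  into the smaller set \<open>{..<i}\<close>; the opposite inequality comes from
  \<open>inv' \<pi>\<close>.\<close>

lemma simplex_mor_rearrangement:
  assumes \<phi>: "\<phi> \<in> simplex_mor m n" and \<psi>: "\<psi> \<in> simplex_mor m n"
    and \<pi>: "\<pi> permutes {..m}" and eq: "\<And>i. i \<le> m \<Longrightarrow> \<psi> i = \<phi> (\<pi> i)"
  shows "\<psi> = \<phi>"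
proof -
  \<comment> \<open>All data are generalised here, so that the inequality also applies with
    \<open>\<phi>\<close> and \<open>\<psi>\<close> exchanged.\<close>
  have le: "\<phi> i \<le> \<psi> i" if i: "i \<le> m" and \<phi>: "\<phi> \<in> simplex_mor m n" and \<psi>: "\<psi> \<in> simplex_mor m n"
    and \<pi>: "\<pi> permutes {..m}" and eq: "\<And>i. i \<le> m \<Longrightarrow> \<psi> i = \<phi> (\<pi> i)" for i \<phi> \<psi> \<pi>
  proof (rule ccontr)
    assume less: "\<not> \<phi> i \<le> \<psi> i"
    have "\<pi> k < i" if "k \<le> i" for k
    proof -
      have "\<phi> (\<pi> k) \<le> \<psi> i"
        using that i simplex_mor_mono[OF \<psi>, of k i] eq[of k] by simp
      moreover have "\<pi> k \<le> m" using permutes_in_image[OF \<pi>, of k] that i by auto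
      ultimately show ?thesis using simplex_mor_cancel[OF \<phi>, of "\<pi> k" i] less by simp
    qed
    then have "card {..i} \<le> card {..<i}"
      by (intro card_inj_on_le[of \<pi>] permutes_inj_on[OF \<pi>]) auto
    then show False by simp
  qed
  have "\<phi> i = \<psi> (inv' \<pi> i)" if "i \<le> m" for i
    using eq[of "inv' \<pi> i"] permutes_in_image[OF permutes_inv[OF \<pi>], of i] that
    by (simp add: permutes_inverses[OF \<pi>])
  then have "\<psi> i = \<phi> i" if "i \<le> m" for i
    using le[OF that \<phi> \<psi> \<pi> eq] le[OF that \<psi> \<phi> permutes_inv[OF \<pi>]] by (meson antisym)
  then show ?thesis using \<phi> \<psi> by (intro simplex_mor_eqI)
qed

text \<open>A surjective self-map of a finite set is a permutation, so \<open>\<phi>\<close> is a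
  monotone rearrangement of the identity.\<close>

lemma simplex_mor_surj_imp_id:
  assumes \<phi>: "\<phi> \<in> simplex_mor n n" and surj: "{..n} \<subseteq> \<phi> ` {..n}"
  shows "\<phi> = (\<lambda>i\<in>{..n}. i)"
proof -
  have im: "\<phi> ` {..n} = {..n}" using surj simplex_mor_le[OF \<phi>] by fastforce
  then have "inj_on \<phi> {..n}" by (intro finite_surj_inj) auto
  \<comment> \<open>\<open>\<phi>\<close> is \<open>undefined\<close> outside \<open>{..n}\<close>
    and has to be continued by the identity to become a permutation.\<close>
  then have "bij_betw (\<lambda>i. if i \<in> {..n} then \<phi> i else i) {..n} {..n}"
    using im by (subst bij_betw_cong[of _ _ \<phi>]) (auto simp: bij_betw_def)
  then have "(\<lambda>i. if i \<in> {..n} then \<phi> i else i) permutes {..n}"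
    by (rule bij_imp_permutes) auto
  from simplex_mor_rearrangement[OF simplex_mor_id \<phi> this] show ?thesis
    using simplex_mor_le[OF \<phi>] by simp
qed

section \<open>Signed lifts\<close>

text \<open>\<open>s j\<close> stands for the entry at \<open>j\<close> being odd. It is read at
  \<open>\<gamma> (\<psi> a) = \<phi> (\<alpha> a)\<close>, as entries are indexed by the target of
  \<open>\<phi>\<close>. With \<open>s\<close> constantly \<open>False\<close> this is the pair
  defining the symmetric crossed simplicial group.\<close>

definition signed_lift ::
  "nat \<Rightarrow> nat \<Rightarrow> (nat \<Rightarrow> bool) \<Rightarrow> (nat \<Rightarrow> nat) \<Rightarrow> (nat \<Rightarrow> nat) \<Rightarrow> (nat \<Rightarrow> nat) \<Rightarrow> (nat \<Rightarrow> nat) \<Rightarrow> bool"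
  where
  "signed_lift m n s \<gamma> \<phi> \<psi> \<alpha> \<longleftrightarrow>
     \<psi> \<in> simplex_mor m n \<and> \<alpha> permutes {..m} \<and> (\<forall>i\<le>m. \<gamma> (\<psi> i) = \<phi> (\<alpha> i)) \<and>
     (\<forall>a b. a < b \<longrightarrow> b \<le> m \<longrightarrow> \<psi> a = \<psi> b \<longrightarrow> (if s (\<gamma> (\<psi> a)) then \<alpha> b < \<alpha> a else \<alpha> a < \<alpha> b))"

lemma signed_liftD:
  assumes "signed_lift m n s \<gamma> \<phi> \<psi> \<alpha>"
  shows "\<psi> \<in> simplex_mor m n" "\<alpha> permutes {..m}" "\<And>i. i \<le> m \<Longrightarrow> \<gamma> (\<psi> i) = \<phi> (\<alpha> i)"
    "\<And>a b. a < b \<Longrightarrow> b \<le> m \<Longrightarrow> \<psi> a = \<psi> b \<Longrightarrow> (if s (\<gamma> (\<psi> a)) then \<alpha> b < \<alpha> a else \<alpha> a < \<alpha> b)"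
  using assms unfolding signed_lift_def by blast+

text \<open>A signed lift amounts to sorting \<open>{..m}\<close> by \<open>inv' \<gamma> \<circ> \<phi>\<close>, ties being broken increasingly
  or decreasingly according to the sign; this gives existence and uniqueness at once.\<close>

lemma signed_lift_iff_sorting:
  fixes s :: "nat \<Rightarrow> bool"
  assumes \<gamma>: "\<gamma> permutes {..n}" and \<phi>: "\<phi> \<in> simplex_mor m n"
  defines "key \<equiv> \<lambda>i. inv' \<gamma> (\<phi> i) * Suc m + (if s (\<phi> i) then m - i else i)"
  shows "signed_lift m n s \<gamma> \<phi> \<psi> \<alpha> \<longleftrightarrow>
    (\<alpha> permutes {..m} \<and> strict_mono_on {..m} (key \<circ> \<alpha>)) \<and> \<psi> = (\<lambda>i\<in>{..m}. inv' \<gamma> (\<phi> (\<alpha> i)))"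
    (is "_ \<longleftrightarrow> ?R")
proof -
  note inv = permutes_inverses[OF \<gamma>]
  \<comment> \<open>Equal leading digits force \<open>\<phi> i = \<phi> j\<close>, hence a common
    sign; subtraction from \<open>m\<close> then reverses the order on \<open>{..m}\<close> without
    truncation.\<close>
  have key_less: "key i < key j \<longleftrightarrow> inv' \<gamma> (\<phi> i) < inv' \<gamma> (\<phi> j) \<or>
      \<phi> i = \<phi> j \<and> (if s (\<phi> i) then j < i else i < j)" if "i \<le> m" "j \<le> m" for i j
  proof -
    have "inv' \<gamma> (\<phi> i) = inv' \<gamma> (\<phi> j) \<longleftrightarrow> \<phi> i = \<phi> j" by (metis inv(1))
    then show ?thesis unfolding key_def using that by (subst mixed_radix_less_iff) auto
  qed
  show ?thesis
  proof
    assume L: "signed_lift m n s \<gamma> \<phi> \<psi> \<alpha>"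
    note D = signed_liftD[OF L]
    have \<psi>: "inv' \<gamma> (\<phi> (\<alpha> i)) = \<psi> i" if "i \<le> m" for i
      using D(3)[OF that] by (metis inv(2))
    have "\<psi> = (\<lambda>i\<in>{..m}. inv' \<gamma> (\<phi> (\<alpha> i)))"
      using D(1) by (intro extensionalityI[of _ "{..m}"]) (auto simp: \<psi> simplex_mor_def PiE_def)
    moreover have "strict_mono_on {..m} (key \<circ> \<alpha>)"
    proof (rule strict_mono_onI)
      fix a b assume ab: "a \<in> {..m}" "b \<in> {..m}" "a < b"
      have "\<alpha> a \<le> m" "\<alpha> b \<le> m"
        using permutes_in_image[OF D(2), of a] permutes_in_image[OF D(2), of b] ab by auto
      moreover have "\<psi> a \<le> \<psi> b" using simplex_mor_mono[OF D(1)] ab by auto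
      ultimately show "(key \<circ> \<alpha>) a < (key \<circ> \<alpha>) b"
        using D(4)[of a b] D(3)[of a] D(3)[of b] ab by (auto simp: key_less \<psi>)
    qed
    ultimately show ?R using D(2) by simp
  next
    assume R: ?R
    then have \<alpha>: "\<alpha> permutes {..m}" and mono: "strict_mono_on {..m} (key \<circ> \<alpha>)"
      and \<psi>: "\<psi> = (\<lambda>i\<in>{..m}. inv' \<gamma> (\<phi> (\<alpha> i)))" by auto
    have le: "\<alpha> a \<le> m" if "a \<le> m" for a
      using permutes_in_image[OF \<alpha>, of a] that by auto
    have less: "inv' \<gamma> (\<phi> (\<alpha> a)) < inv' \<gamma> (\<phi> (\<alpha> b)) \<or>
      \<phi> (\<alpha> a) = \<phi> (\<alpha> b) \<and> (if s (\<phi> (\<alpha> a)) then \<alpha> b < \<alpha> a else \<alpha> a < \<alpha> b)" if "a < b" "b \<le> m" for a b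
      using strict_mono_onD[OF mono, of a b] that le[of a] le[of b] by (simp add: key_less)
    have "inv' \<gamma> (\<phi> (\<alpha> i)) \<le> n" if "i \<le> m" for i
      using permutes_in_image[OF permutes_inv[OF \<gamma>], of "\<phi> (\<alpha> i)"] simplex_mor_le[OF \<phi> le[OF that]]
      by auto
    moreover have "mono_on {..m} \<psi>"
    proof (rule monotone_onI)
      fix a b assume "a \<in> {..m}" "b \<in> {..m}" "a \<le> b"
      then show "\<psi> a \<le> \<psi> b" using less[of a b] by (cases "a = b") (auto simp: \<psi>)
    qed
    ultimately have "\<psi> \<in> simplex_mor m n" by (auto simp: simplex_mor_def \<psi>)
    moreover have "if s (\<gamma> (\<psi> a)) then \<alpha> b < \<alpha> a else \<alpha> a < \<alpha> b"
      if "a < b" "b \<le> m" "\<psi> a = \<psi> b" for a b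
      using less[of a b] that by (auto simp: \<psi> inv)
    ultimately show "signed_lift m n s \<gamma> \<phi> \<psi> \<alpha>"
      using \<alpha> by (auto simp: signed_lift_def \<psi> inv)
  qed
qed

lemma ex1_signed_lift:
  assumes \<gamma>: "\<gamma> permutes {..n}" and \<phi>: "\<phi> \<in> simplex_mor m n"
  shows "\<exists>!(\<psi>, \<alpha>). signed_lift m n s \<gamma> \<phi> \<psi> \<alpha>"
proof -
  define key where "key = (\<lambda>i. inv' \<gamma> (\<phi> i) * Suc m + (if s (\<phi> i) then m - i else i))"
  have "inj_on key {..m}"
  proof (rule inj_onI)
    fix i j assume ij: "i \<in> {..m}" "j \<in> {..m}" "key i = key j"
    have *: "key k < key l \<longleftrightarrow> inv' \<gamma> (\<phi> k) < inv' \<gamma> (\<phi> l) \<or> inv' \<gamma> (\<phi> k) = inv' \<gamma> (\<phi> l) \<and>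
        (if s (\<phi> k) then m - k else k) < (if s (\<phi> l) then m - l else l)" if "k \<le> m" "l \<le> m" for k l
      unfolding key_def using that by (intro mixed_radix_less_iff) auto
    \<comment> \<open>Equal keys have equal digits. The first recovers \<open>\<phi> i\<close> and
      with it the sign, the second then recovers \<open>i\<close>.\<close>
    have "inv' \<gamma> (\<phi> i) = inv' \<gamma> (\<phi> j)"
      "(if s (\<phi> i) then m - i else i) = (if s (\<phi> j) then m - j else j)"
      using *[of i j] *[of j i] ij by (auto simp: neq_iff)
    moreover have "\<phi> i = \<phi> j" using calculation(1) permutes_inverses(1)[OF \<gamma>] by metis
    ultimately show "i = j" using ij by (auto split: if_splits)
  qed
  from ex1_sorting_permutation[OF this] show ?thesis
    unfolding signed_lift_iff_sorting[OF assms] key_def[symmetric] by auto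
qed

section \<open>Uniqueness and calculus of signed lifts\<close>

lemma signed_lift_unique:
  assumes "\<gamma> permutes {..n}" "\<phi> \<in> simplex_mor m n"
    and "signed_lift m n s \<gamma> \<phi> \<psi> \<alpha>" "signed_lift m n s \<gamma> \<phi> \<psi>' \<alpha>'"
  shows "\<psi> = \<psi>'" "\<alpha> = \<alpha>'"
  using ex1_signed_lift[OF assms(1,2), of s] assms(3,4) by auto

text \<open>Signs are read only at values \<open>\<gamma> (\<psi> a)\<close>, which lie in
  \<open>{..n}\<close>. Tuples are \<open>undefined\<close> beyond that range, so signs computed in
  two ways agree only there.\<close>

lemma signed_lift_cong:
  assumes "\<gamma> permutes {..n}" "\<And>j. j \<le> n \<Longrightarrow> s j = t j" "signed_lift m n s \<gamma> \<phi> \<psi> \<alpha>"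
  shows "signed_lift m n t \<gamma> \<phi> \<psi> \<alpha>"
proof -
  note D = signed_liftD[OF assms(3)]
  have "s (\<gamma> (\<psi> a)) = t (\<gamma> (\<psi> a))" if "a \<le> m" for a
    using assms(2) simplex_mor_le[OF D(1) that] permutes_in_image[OF assms(1), of "\<psi> a"] by auto
  then show ?thesis using D unfolding signed_lift_def by (metis less_le_trans less_imp_le)
qed

text \<open>Here \<open>\<psi>\<close> is \<open>\<phi>\<close> rearranged by
  \<open>\<alpha>\<close>, and both are monotone.\<close>

lemma signed_lift_id_left:
  assumes "signed_lift m n s id \<phi> \<psi> \<alpha>" "\<phi> \<in> simplex_mor m n"
  shows "\<psi> = \<phi>"
  using signed_liftD[OF assms(1)] by (intro simplex_mor_rearrangement[OF assms(2)]) auto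

lemma signed_lift_inj:
  assumes "\<phi> \<in> simplex_mor m n" "inj_on \<phi> {..m}"
  shows "signed_lift m n s id \<phi> \<phi> id"
  unfolding signed_lift_def using assms by (auto simp: permutes_id dest: inj_onD)

lemma signed_lift_one:
  assumes "\<phi> \<in> simplex_mor m n"
  shows "signed_lift m n (\<lambda>_. False) id \<phi> \<phi> id"
  unfolding signed_lift_def using assms by (auto simp: permutes_id)

lemma signed_lift_id:
  assumes "\<gamma> permutes {..n}"
  shows "signed_lift n n s \<gamma> (\<lambda>i\<in>{..n}. i) (\<lambda>i\<in>{..n}. i) \<gamma>"
  unfolding signed_lift_def using assms simplex_mor_id permutes_in_image[OF assms] by auto

text \<open>On a fibre of \<open>\<omega>\<close>, \<open>\<epsilon>\<close> reverses according to
  \<open>t\<close> and then \<open>\<alpha>\<close> according to \<open>s\<close>, so reversals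
  combine by exclusive or. The shift by \<open>inv' \<gamma>\<close> is the one in the wreath
  multiplication.\<close>

lemma signed_lift_mult:
  assumes \<gamma>: "\<gamma> permutes {..n}"
    and 1: "signed_lift m n s \<gamma> \<phi> \<psi> \<alpha>" and 2: "signed_lift m n t \<delta> \<psi> \<omega> \<epsilon>"
  shows "signed_lift m n (\<lambda>j. s j \<noteq> t (inv' \<gamma> j)) (\<gamma> \<circ> \<delta>) \<phi> \<omega> (\<alpha> \<circ> \<epsilon>)"
proof -
  note D = signed_liftD[OF 1] and E = signed_liftD[OF 2]
  have le: "\<epsilon> i \<le> m" if "i \<le> m" for i using permutes_in_image[OF E(2), of i] that by auto
  have order: "if s ((\<gamma> \<circ> \<delta>) (\<omega> a)) \<noteq> t (inv' \<gamma> ((\<gamma> \<circ> \<delta>) (\<omega> a)))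
      then (\<alpha> \<circ> \<epsilon>) b < (\<alpha> \<circ> \<epsilon>) a else (\<alpha> \<circ> \<epsilon>) a < (\<alpha> \<circ> \<epsilon>) b"
    if ab: "a < b" "b \<le> m" "\<omega> a = \<omega> b" for a b
  proof -
    \<comment> \<open>\<open>\<epsilon>\<close> maps a fibre of \<open>\<omega>\<close> into a
      single fibre of \<open>\<psi>\<close>, where the order rule for \<open>\<alpha>\<close>
      applies.\<close>
    have "\<psi> (\<epsilon> a) = \<delta> (\<omega> a)" "\<psi> (\<epsilon> b) = \<delta> (\<omega> a)" using E(3)[of a] E(3)[of b] ab by auto
    then show ?thesis
      using E(4)[OF ab] D(4)[of "\<epsilon> a" "\<epsilon> b"] D(4)[of "\<epsilon> b" "\<epsilon> a"] le[of a] le[of b] ab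
      by (auto simp: permutes_inverses(2)[OF \<gamma>] split: if_splits)
  qed
  have "(\<gamma> \<circ> \<delta>) (\<omega> i) = \<phi> ((\<alpha> \<circ> \<epsilon>) i)" if "i \<le> m" for i
    using D(3) E(3) le that by simp
  then show ?thesis
    unfolding signed_lift_def using order E(1) permutes_compose[OF E(2) D(2)] by blast
qed

text \<open>A fibre of the composite is a union of fibres of \<open>\<omega>\<close>. Inside one of
  them the rule for \<open>\<epsilon>\<close> decides, between two the rule for
  \<open>\<alpha>\<close>; the signs agree by \<open>\<phi> (\<alpha> (\<omega> a)) = \<gamma>
  (\<psi> (\<omega> a))\<close>.\<close>

lemma signed_lift_compose:
  assumes 1: "signed_lift m n s \<gamma> \<phi> \<psi> \<alpha>" and 2: "signed_lift l m (\<lambda>i. s (\<phi> i)) \<alpha> \<chi> \<omega> \<epsilon>"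
    and \<chi>: "\<chi> \<in> simplex_mor l m"
  shows "signed_lift l n s \<gamma> (compose {..l} \<phi> \<chi>) (compose {..l} \<psi> \<omega>) \<epsilon>"
proof -
  note D = signed_liftD[OF 1] and E = signed_liftD[OF 2]
  have le: "\<epsilon> i \<le> l" "\<omega> i \<le> m" if "i \<le> l" for i
    using permutes_in_image[OF E(2), of i] simplex_mor_le[OF E(1), of i] that by auto
  have \<phi>\<alpha>: "\<phi> (\<alpha> (\<omega> i)) = \<gamma> (\<psi> (\<omega> i))" if "i \<le> l" for i using D(3) le that by simp
  have "if s (\<gamma> (\<psi> (\<omega> a))) then \<epsilon> b < \<epsilon> a else \<epsilon> a < \<epsilon> b"
    if ab: "a < b" "b \<le> l" "\<psi> (\<omega> a) = \<psi> (\<omega> b)" for a b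
  proof (cases "\<omega> a = \<omega> b")
    case True
    then show ?thesis using E(4)[of a b] \<phi>\<alpha>[of a] ab by simp
  next
    case False
    then have "\<omega> a < \<omega> b" using simplex_mor_mono[OF E(1), of a b] ab by simp
    \<comment> \<open>As \<open>\<alpha> (\<omega> a) = \<chi> (\<epsilon> a)\<close>, the rule for
      \<open>\<alpha>\<close> compares values of \<open>\<chi>\<close>; monotonicity of
      \<open>\<chi>\<close> passes the strict inequality on to \<open>\<epsilon>\<close>.\<close>
    then have "if s (\<gamma> (\<psi> (\<omega> a))) then \<chi> (\<epsilon> b) < \<chi> (\<epsilon> a) else \<chi> (\<epsilon> a) < \<chi> (\<epsilon> b)"
      using D(4)[of "\<omega> a" "\<omega> b"] E(3)[of a] E(3)[of b] le[of a] le[of b] ab by auto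
    then show ?thesis using simplex_mor_cancel[OF \<chi>] le[of a] le[of b] ab by (auto split: if_splits)
  qed
  then show ?thesis
    using D(3) E simplex_mor_compose[OF D(1) E(1)] le \<phi>\<alpha> by (auto simp: signed_lift_def compose_def)
qed

section \<open>Lifts of faces and degeneracies\<close>

lemma face_mor: "i \<le> Suc n \<Longrightarrow> face n i \<in> simplex_mor n (Suc n)"
  by (auto simp: face_def simplex_mor_def monotone_on_def)

lemma degen_mor: "i \<le> n \<Longrightarrow> degen n i \<in> simplex_mor (Suc n) n"
  by (auto simp: degen_def simplex_mor_def monotone_on_def)

lemma signed_lift_face:
  "i \<le> Suc n \<Longrightarrow> signed_lift n (Suc n) s id (face n i) (face n i) id"
  by (intro signed_lift_inj face_mor) (auto simp: face_def inj_on_def split: if_splits)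

text \<open>The only fibre with more than one point is \<open>{i, Suc i}\<close>, and the
  transposition reverses it.\<close>

lemma signed_lift_degen:
  assumes "i \<le> n"
  shows "signed_lift (Suc n) n s id (degen n i) (degen n i) (if s i then transpose i (Suc i) else id)"
proof -
  have fibre: "a = i \<and> b = Suc i" if "a < b" "b \<le> Suc n" "degen n i a = degen n i b" for a b
    using that by (auto simp: degen_def split: if_splits)
  have "degen n i (transpose i (Suc i) k) = degen n i k" if "k \<le> Suc n" for k
    using assms that by (auto simp: degen_def transpose_def)
  moreover have "transpose i (Suc i) permutes {..Suc n}"
    using assms by (intro permutes_swap_id) auto
  moreover have "degen n i i = i" using assms by (simp add: degen_def)
  ultimately show ?thesis
    using degen_mor[OF assms] by (auto simp: signed_lift_def permutes_id dest!: fibre)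
qed

section \<open>Comparison with the symmetric crossed simplicial group\<close>

text \<open>A permutation that is weakly increasing on a fibre is strictly increasing there, so
  \<open>sym_pair\<close> describes the lift without odd entries. Unique existence of lifts makes
  its definite description meaningful.\<close>

lemma sym_pair_eq:
  assumes \<gamma>: "\<gamma> permutes {..n}" and \<phi>: "\<phi> \<in> simplex_mor m n"
    and lift: "signed_lift m n (\<lambda>_. False) \<gamma> \<phi> \<psi> \<beta>"
  shows "sym_pair m n \<gamma> \<phi> = (\<psi>, \<beta>)"
proof -
  have iff: "signed_lift m n (\<lambda>_. False) \<gamma> \<phi> \<psi> \<beta> \<longleftrightarrow>
     \<psi> \<in> mor simplex_cat m n \<and> \<beta> permutes {..m} \<and> (\<forall>i \<le> m. \<gamma> (\<psi> i) = \<phi> (\<beta> i)) \<and>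
     (\<forall>j \<le> n. mono_on {i \<in> {..m}. \<psi> i = j} \<beta>)" for \<psi> \<beta>
  proof -
    have "(\<forall>a b. a < b \<longrightarrow> b \<le> m \<longrightarrow> \<psi> a = \<psi> b \<longrightarrow> \<beta> a < \<beta> b) \<longleftrightarrow>
        (\<forall>j \<le> n. mono_on {i \<in> {..m}. \<psi> i = j} \<beta>)" (is "?L \<longleftrightarrow> ?R")
      if \<psi>: "\<psi> \<in> simplex_mor m n" and \<beta>: "\<beta> permutes {..m}"
    proof
      assume ?L
      show ?R
      proof (intro allI impI monotone_onI)
        fix j a b assume "a \<in> {i \<in> {..m}. \<psi> i = j}" "b \<in> {i \<in> {..m}. \<psi> i = j}" "a \<le> b"
        then show "\<beta> a \<le> \<beta> b" using \<open>?L\<close> by (cases "a = b") (auto simp: less_imp_le)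
      qed
    next
      assume ?R
      show ?L
      proof (intro allI impI)
        fix a b assume ab: "a < b" "b \<le> m" "\<psi> a = \<psi> b"
        have "mono_on {i \<in> {..m}. \<psi> i = \<psi> a} \<beta>" using \<open>?R\<close> simplex_mor_le[OF \<psi>, of a] ab by auto
        then have "\<beta> a \<le> \<beta> b" using ab by (auto dest: monotone_onD[where x=a and y=b])
        moreover have "\<beta> a \<noteq> \<beta> b" using permutes_inj[OF \<beta>] ab by (auto dest: injD)
        ultimately show "\<beta> a < \<beta> b" by simp
      qed
    qed
    then show ?thesis by (auto simp: signed_lift_def simplex_cat_def)
  qed
  have "sym_pair m n \<gamma> \<phi> = (THE (\<psi>, \<beta>). signed_lift m n (\<lambda>_. False) \<gamma> \<phi> \<psi> \<beta>)"
    unfolding sym_pair_def iff ..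
  also have "\<dots> = (\<psi>, \<beta>)"
    by (rule the1_equality[OF ex1_signed_lift[OF \<gamma> \<phi>]]) (simp add: lift)
  finally show ?thesis .
qed

text \<open>Only the permutation is named: the monotone part does not depend on \<open>s\<close> and
  is already \<open>sym_act\<close>.\<close>

definition lift_perm ::
  "nat \<Rightarrow> nat \<Rightarrow> (nat \<Rightarrow> bool) \<Rightarrow> (nat \<Rightarrow> nat) \<Rightarrow> (nat \<Rightarrow> nat) \<Rightarrow> (nat \<Rightarrow> nat)" where
  "lift_perm m n s \<gamma> \<phi> = (THE \<alpha>. \<exists>\<psi>. signed_lift m n s \<gamma> \<phi> \<psi> \<alpha>)"

lemma lift_perm_eq:
  assumes "\<gamma> permutes {..n}" "\<phi> \<in> simplex_mor m n" "signed_lift m n s \<gamma> \<phi> \<psi> \<alpha>"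
  shows "lift_perm m n s \<gamma> \<phi> = \<alpha>"
  unfolding lift_perm_def using signed_lift_unique[OF assms(1,2) _ assms(3)] assms(3) by blast

text \<open>Multiply the lift for the signs \<open>s\<close> and the identity by the unsigned lift
  for \<open>\<gamma>\<close>: exclusive or with \<open>False\<close> leaves \<open>s\<close>
  unchanged. This is the permutation part of splitting \<open>(g, \<gamma>)\<close> as
  \<open>(g, id)\<close> times \<open>(e, \<gamma>)\<close>.\<close>

lemma signed_lift_decompose:
  assumes \<gamma>: "\<gamma> permutes {..n}" and \<phi>: "\<phi> \<in> simplex_mor m n"
  shows "signed_lift m n s \<gamma> \<phi> (sym_act m n \<gamma> \<phi>) (lift_perm m n s id \<phi> \<circ> sym_pull m n \<phi> \<gamma>)"
proof -
  obtain \<psi> \<beta> where 1: "signed_lift m n (\<lambda>_. False) \<gamma> \<phi> \<psi> \<beta>"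
    using ex1_signed_lift[OF assms] by blast
  obtain \<psi>' \<rho> where 2: "signed_lift m n s id \<phi> \<psi>' \<rho>"
    using ex1_signed_lift[OF permutes_id \<phi>] by blast
  from signed_lift_id_left[OF 2 \<phi>] have [simp]: "\<psi>' = \<phi>" .
  have "signed_lift m n s \<gamma> \<phi> \<psi> (\<rho> \<circ> \<beta>)"
    using signed_lift_mult[OF permutes_id 2, of "\<lambda>_. False" \<gamma> \<psi> \<beta>] 1 by simp
  then show ?thesis
    using sym_pair_eq[OF assms 1] lift_perm_eq[OF permutes_id \<phi> 2]
    by (simp add: sym_act_def sym_pull_def)
qed

lemma lift_perm_decompose:
  assumes "\<gamma> permutes {..n}" "\<phi> \<in> simplex_mor m n"
  shows "lift_perm m n s \<gamma> \<phi> = lift_perm m n s id \<phi> \<circ> sym_pull m n \<phi> \<gamma>"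
  by (rule lift_perm_eq[OF assms signed_lift_decompose[OF assms]])

lemma signed_lift_lift_perm:
  assumes "\<gamma> permutes {..n}" "\<phi> \<in> simplex_mor m n"
  shows "signed_lift m n s \<gamma> \<phi> (sym_act m n \<gamma> \<phi>) (lift_perm m n s \<gamma> \<phi>)"
  using signed_lift_decompose[OF assms] lift_perm_decompose[OF assms] by simp

lemma sym_act_eq:
  assumes "\<gamma> permutes {..n}" "\<phi> \<in> simplex_mor m n" "signed_lift m n s \<gamma> \<phi> \<psi> \<alpha>"
  shows "sym_act m n \<gamma> \<phi> = \<psi>"
  using signed_lift_unique(1)[OF assms(1,2) signed_lift_lift_perm[OF assms(1,2)] assms(3)] .

lemma lift_perm_cong:
  assumes "\<gamma> permutes {..n}" "\<phi> \<in> simplex_mor m n" "\<And>j. j \<le> n \<Longrightarrow> s j = t j"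
  shows "lift_perm m n s \<gamma> \<phi> = lift_perm m n t \<gamma> \<phi>"
  by (rule lift_perm_eq[OF assms(1,2) signed_lift_cong[OF assms(1) _ signed_lift_lift_perm[OF assms(1,2)]]])
    (simp add: assms(3))

lemma lift_perm_False:
  assumes "\<gamma> permutes {..n}" "\<phi> \<in> simplex_mor m n"
  shows "lift_perm m n (\<lambda>_. False) \<gamma> \<phi> = sym_pull m n \<phi> \<gamma>"
  using lift_perm_decompose[OF assms, of "\<lambda>_. False"]
    lift_perm_eq[OF permutes_id assms(2) signed_lift_one[OF assms(2)]] by simp

section \<open>Generation by faces and degeneracies\<close>

text \<open>By induction on \<open>m + n\<close>, a skipped value splits off a face and a repeated
  value splits off a degeneracy. A map with neither is bijective and monotone, hence the
  identity.\<close>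

lemma simplex_generators_induct [consumes 1, case_names face degen compose]:
  assumes "\<phi> \<in> simplex_mor m n"
    and face: "\<And>n i. i \<le> Suc n \<Longrightarrow> S n (Suc n) (face n i)"
    and degen: "\<And>n i. i \<le> n \<Longrightarrow> S (Suc n) n (degen n i)"
    and compose: "\<And>l m n \<phi> \<psi>. \<phi> \<in> simplex_mor m n \<Longrightarrow> \<psi> \<in> simplex_mor l m \<Longrightarrow>
      S m n \<phi> \<Longrightarrow> S l m \<psi> \<Longrightarrow> S l n (compose {..l} \<phi> \<psi>)"
  shows "S m n \<phi>"
  using assms(1)
proof (induction "m + n" arbitrary: m n \<phi> rule: less_induct)
  case less
  note \<phi> = less.prems
  consider (skip) i where "i \<le> n" "i \<notin> \<phi> ` {..m}" | (rep) i where "i < m" "\<phi> i = \<phi> (Suc i)"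
    | (bij) "{..n} \<subseteq> \<phi> ` {..m}" "\<And>i. i < m \<Longrightarrow> \<phi> i \<noteq> \<phi> (Suc i)" by blast
  then show ?case
  proof cases
    case (skip i)
    have "n \<noteq> 0" using skip simplex_mor_le[OF \<phi>, of 0] by (metis atMost_iff image_eqI le_0_eq zero_le)
    then obtain k where n: "n = Suc k" by (cases n) auto
    \<comment> \<open>Closing the gap at \<open>i\<close>: values not below \<open>i\<close> exceed
      it, so the subtraction does not truncate.\<close>
    define \<psi> where "\<psi> = (\<lambda>j\<in>{..m}. if \<phi> j < i then \<phi> j else \<phi> j - 1)"
    have ne: "\<phi> j \<noteq> i" if "j \<le> m" for j using skip that by auto
    have "\<psi> j \<le> k" if "j \<le> m" for j
      using simplex_mor_le[OF \<phi> that] ne[OF that] skip(1) that n by (auto simp: \<psi>_def)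
    moreover have "\<psi> a \<le> \<psi> b" if "a \<le> b" "b \<le> m" for a b
      using simplex_mor_mono[OF \<phi> that] that by (auto simp: \<psi>_def)
    ultimately have \<psi>: "\<psi> \<in> simplex_mor m k"
      by (intro simplex_morI) (auto simp: \<psi>_def)
    have "compose {..m} (face k i) \<psi> = \<phi>"
    proof (rule simplex_mor_eqI[OF simplex_mor_compose[OF _ \<psi>] \<phi>])
      show "face k i \<in> simplex_mor k n" using skip n by (auto intro!: face_mor)
      fix j assume j: "j \<le> m"
      have "compose {..m} (face k i) \<psi> j = (if \<psi> j < i then \<psi> j else Suc (\<psi> j))"
        using j simplex_mor_le[OF \<psi> j] by (simp add: compose_def face_def)
      also have "\<dots> = \<phi> j" using j ne[OF j] by (auto simp: \<psi>_def)
      finally show "compose {..m} (face k i) \<psi> j = \<phi> j" .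
    qed
    moreover have "S m n (compose {..m} (face k i) \<psi>)"
      using skip n less.hyps[OF _ \<psi>] \<psi> face by (auto intro!: compose face_mor)
    ultimately show ?thesis by simp
  next
    case (rep i)
    then obtain k where m: "m = Suc k" by (cases m) auto
    \<comment> \<open>Position \<open>Suc i\<close>, which repeats the value at \<open>i\<close>, is
      dropped.\<close>
    define \<psi> where "\<psi> = (\<lambda>j\<in>{..k}. if j \<le> i then \<phi> j else \<phi> (Suc j))"
    have \<psi>: "\<psi> \<in> simplex_mor k n"
      using simplex_mor_le[OF \<phi>] simplex_mor_mono[OF \<phi>]
      by (auto simp: simplex_mor_def \<psi>_def m monotone_on_def)
    have "compose {..m} \<psi> (degen k i) = \<phi>"
    proof (rule simplex_mor_eqI[OF simplex_mor_compose[OF \<psi>] \<phi>])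
      show "degen k i \<in> simplex_mor m k" using rep m by (auto intro!: degen_mor)
      fix j assume j: "j \<le> m"
      show "compose {..m} \<psi> (degen k i) j = \<phi> j"
        using j rep m by (cases "j = Suc i") (auto simp: compose_def degen_def \<psi>_def)
    qed
    moreover have "S m n (compose {..m} \<psi> (degen k i))"
      using rep m less.hyps[OF _ \<psi>] \<psi> degen by (auto intro!: compose degen_mor)
    ultimately show ?thesis by simp
  next
    case bij
    have less: "\<phi> i < \<phi> (Suc i)" if "i < m" for i
      using simplex_mor_mono[OF \<phi>, of i "Suc i"] bij(2)[OF that] that by simp
    have "i \<le> \<phi> i" if "i \<le> m" for i
      using that
    proof (induction i)
      case (Suc i)
      then show ?case using less[of i] by simp
    qed simp
    from this[of m] have "m \<le> n" using simplex_mor_le[OF \<phi>, of m] by simp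
    moreover have "card {..n} \<le> card (\<phi> ` {..m})" using bij(1) by (intro card_mono) auto
    then have "n \<le> m" using card_image_le[of "{..m}" \<phi>] by simp
    ultimately have "m = n" by simp
    then have "\<phi> = (\<lambda>i\<in>{..n}. i)" using bij(1) \<phi> simplex_mor_surj_imp_id by simp
    \<comment> \<open>The identity is a product of generators through the larger object
      \<open>Suc n\<close>, so the generator cases are used directly instead of the induction
      hypothesis.\<close>
    also have "\<dots> = compose {..n} (degen n 0) (face n 0)"
      by (auto simp: compose_def face_def degen_def)
    finally show ?thesis using \<open>m = n\<close> degen[of 0 n] face[of 0 n] degen_mor[of 0 n] face_mor[of 0 n]
      by (simp add: compose)
  qed
qed

section \<open>Crossed simplicial groups from actions and pullbacks\<close>

text \<open>The category has pairs \<open>(\<phi>, g)\<close> as morphisms. The group factor of a composite is multiplied in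
  reverse, as $\mathrm{Aut}([n])$ is \<open>G n\<close> with the opposite multiplication.\<close>

lemma defines_crossed_simplicial_groupI:
  fixes G :: "nat \<Rightarrow> 'g monoid"
  assumes group: "\<And>n. group (G n)"
    and act_mor: "\<And>m n g \<phi>. g \<in> carrier (G n) \<Longrightarrow> \<phi> \<in> simplex_mor m n \<Longrightarrow> act m n g \<phi> \<in> simplex_mor m n"
    and pull_closed: "\<And>m n g \<phi>. g \<in> carrier (G n) \<Longrightarrow> \<phi> \<in> simplex_mor m n \<Longrightarrow> pull m n \<phi> g \<in> carrier (G m)"
    and pull_compose: "\<And>l m n g \<phi> \<psi>. g \<in> carrier (G n) \<Longrightarrow> \<phi> \<in> simplex_mor m n \<Longrightarrow> \<psi> \<in> simplex_mor l m \<Longrightarrow>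
      pull l n (compose {..l} \<phi> \<psi>) g = pull l m \<psi> (pull m n \<phi> g)"
    and pull_id: "\<And>n g. g \<in> carrier (G n) \<Longrightarrow> pull n n (\<lambda>i\<in>{..n}. i) g = g"
    and pull_one: "\<And>m n \<phi>. \<phi> \<in> simplex_mor m n \<Longrightarrow> pull m n \<phi> \<one>\<^bsub>G n\<^esub> = \<one>\<^bsub>G m\<^esub>"
    and act_mult: "\<And>m n g h \<phi>. g \<in> carrier (G n) \<Longrightarrow> h \<in> carrier (G n) \<Longrightarrow> \<phi> \<in> simplex_mor m n \<Longrightarrow>
      act m n (g \<otimes>\<^bsub>G n\<^esub> h) \<phi> = act m n h (act m n g \<phi>)"
    and act_one: "\<And>m n \<phi>. \<phi> \<in> simplex_mor m n \<Longrightarrow> act m n \<one>\<^bsub>G n\<^esub> \<phi> = \<phi>"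
    and act_id: "\<And>n g. g \<in> carrier (G n) \<Longrightarrow> act n n g (\<lambda>i\<in>{..n}. i) = (\<lambda>i\<in>{..n}. i)"
    and act_compose: "\<And>l m n g \<phi> \<psi>. g \<in> carrier (G n) \<Longrightarrow> \<phi> \<in> simplex_mor m n \<Longrightarrow> \<psi> \<in> simplex_mor l m \<Longrightarrow>
      act l n g (compose {..l} \<phi> \<psi>) = compose {..l} (act m n g \<phi>) (act l m (pull m n \<phi> g) \<psi>)"
    and pull_mult: "\<And>m n g h \<phi>. g \<in> carrier (G n) \<Longrightarrow> h \<in> carrier (G n) \<Longrightarrow> \<phi> \<in> simplex_mor m n \<Longrightarrow>
      pull m n \<phi> (g \<otimes>\<^bsub>G n\<^esub> h) = pull m n \<phi> g \<otimes>\<^bsub>G m\<^esub> pull m n (act m n g \<phi>) h"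
  shows "defines_crossed_simplicial_group G act pull"
proof -
  let ?id = "\<lambda>n::nat. \<lambda>i\<in>{..n}. i"
  \<comment> \<open>A pair stands for the group element followed by the monotone map. In the
    composite of \<open>(\<phi>, g)\<close> and \<open>(\<psi>, h)\<close>, the inner
    \<open>g\<close> is moved past \<open>\<psi>\<close>, becoming its pullback along
    \<open>\<psi>\<close> and turning \<open>\<psi>\<close> into
    \<open>act l m g \<psi>\<close>.\<close>
  define C :: "((nat \<Rightarrow> nat) \<times> 'g) ncat" where "C =
    \<lparr>mor = (\<lambda>m n. simplex_mor m n \<times> carrier (G m)),
     cmp = (\<lambda>l m n (\<phi>, g) (\<psi>, h).
       (compose {..l} \<phi> (act l m g \<psi>), h \<otimes>\<^bsub>G l\<^esub> pull l m \<psi> g)),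
     idt = (\<lambda>n. (?id n, \<one>\<^bsub>G n\<^esub>))\<rparr>"
  have C [simp]: "mor C m n = simplex_mor m n \<times> carrier (G m)" "idt C n = (?id n, \<one>\<^bsub>G n\<^esub>)"
    "cmp C l m n (\<phi>, g) (\<psi>, h) = (compose {..l} \<phi> (act l m g \<psi>), h \<otimes>\<^bsub>G l\<^esub> pull l m \<psi> g)"
    for l m n \<phi> g \<psi> h by (simp_all add: C_def)
  have \<Delta> [simp]: "mor simplex_cat = simplex_mor" "idt simplex_cat n = ?id n"
    "cmp simplex_cat l m n \<phi> \<psi> = compose {..l} \<phi> \<psi>" for l m n \<phi> \<psi>
    by (simp_all add: simplex_cat_def)
  have one [simp]: "\<one>\<^bsub>G n\<^esub> \<in> carrier (G n)" for n
    using group by (simp add: group.is_monoid monoid.one_closed)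
  have mult [simp]: "g \<otimes>\<^bsub>G n\<^esub> h \<in> carrier (G n)" if "g \<in> carrier (G n)" "h \<in> carrier (G n)" for g h n
    using group that by (simp add: group.is_monoid monoid.m_closed)
  have unit [simp]: "\<one>\<^bsub>G n\<^esub> \<otimes>\<^bsub>G n\<^esub> g = g" "g \<otimes>\<^bsub>G n\<^esub> \<one>\<^bsub>G n\<^esub> = g" if "g \<in> carrier (G n)" for g n
    using group that by (simp_all add: group.is_monoid monoid.l_one monoid.r_one)
  have assoc: "g \<otimes>\<^bsub>G n\<^esub> h \<otimes>\<^bsub>G n\<^esub> k = g \<otimes>\<^bsub>G n\<^esub> (h \<otimes>\<^bsub>G n\<^esub> k)"
    if "g \<in> carrier (G n)" "h \<in> carrier (G n)" "k \<in> carrier (G n)" for g h k n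
    using group that by (simp add: group.is_monoid monoid.m_assoc)
  note [simp] = act_mor pull_closed simplex_mor_compose simplex_mor_id act_id pull_id act_one pull_one
  have id_left [simp]: "compose {..m} (?id n) \<phi> = \<phi>" if "\<phi> \<in> simplex_mor m n" for m n \<phi>
    by (rule simplex_mor_eqI[OF simplex_mor_compose[OF simplex_mor_id that] that])
      (use simplex_mor_le[OF that] in \<open>simp add: compose_def\<close>)
  have id_right [simp]: "compose {..m} \<phi> (?id m) = \<phi>" if "\<phi> \<in> simplex_mor m n" for m n \<phi>
    by (rule simplex_mor_eqI[OF simplex_mor_compose[OF that simplex_mor_id] that])
      (simp add: compose_def)
  have compose_assoc: "compose {..k} (compose {..l} \<phi> \<psi>) \<chi> = compose {..k} \<phi> (compose {..k} \<psi> \<chi>)"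
    if "\<chi> \<in> simplex_mor k l" for k l \<phi> \<psi> \<chi>
    using simplex_mor_le[OF that] by (auto simp: compose_def)
  interpret C: ncategory C
  proof
    fix f g h and k l m n :: nat
    assume "f \<in> mor C m n" "g \<in> mor C l m" "h \<in> mor C k l"
    then obtain \<phi> x \<psi> y \<chi> z where fgh: "f = (\<phi>, x)" "g = (\<psi>, y)" "h = (\<chi>, z)"
      and mem: "\<phi> \<in> simplex_mor m n" "x \<in> carrier (G m)" "\<psi> \<in> simplex_mor l m" "y \<in> carrier (G l)"
        "\<chi> \<in> simplex_mor k l" "z \<in> carrier (G k)" by auto
    \<comment> \<open>On the left a product of \<open>y\<close> with a pullback of \<open>x\<close>
      passes \<open>\<chi>\<close>, expanded by \<open>act_mult\<close> and
      \<open>pull_mult\<close>. On the right \<open>x\<close> passes \<open>\<psi>\<close> composed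
      with \<open>act k l y \<chi>\<close>, expanded by \<open>act_compose\<close> and
      \<open>pull_compose\<close>.\<close>
    have "act k l y \<chi> \<in> simplex_mor k l" using mem by simp
    then show "cmp C k l n (cmp C l m n f g) h = cmp C k m n f (cmp C k l m g h)"
      using act_compose[OF mem(2,3)] pull_compose[OF mem(2,3)] mem
      by (simp add: fgh act_mult pull_mult compose_assoc assoc)
  qed auto
  define \<iota> :: "nat \<Rightarrow> nat \<Rightarrow> (nat \<Rightarrow> nat) \<Rightarrow> (nat \<Rightarrow> nat) \<times> 'g" where "\<iota> = (\<lambda>m n \<phi>. (\<phi>, \<one>\<^bsub>G m\<^esub>))"
  define \<theta> :: "nat \<Rightarrow> 'g \<Rightarrow> (nat \<Rightarrow> nat) \<times> 'g" where "\<theta> = (\<lambda>n g. (?id n, g))"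
  \<comment> \<open>The monotone part of an automorphism has a right inverse, so it is surjective
    and therefore the identity.\<close>
  have aut: "carrier (aut_group C n) = {?id n} \<times> carrier (G n)" for n
  proof (intro equalityI subsetI)
    fix f assume f: "f \<in> carrier (aut_group C n)"
    obtain \<phi> g where [simp]: "f = (\<phi>, g)" by (cases f)
    from f obtain \<phi>' g' where \<phi>': "\<phi>' \<in> simplex_mor n n" "g' \<in> carrier (G n)"
      "compose {..n} \<phi> (act n n g \<phi>') = ?id n" by (auto simp: aut_group_def)
    have fg: "\<phi> \<in> simplex_mor n n" "g \<in> carrier (G n)" using f by (auto simp: aut_group_def)
    have "j \<in> \<phi> ` {..n}" if "j \<le> n" for j
    proof -
      have "\<phi> (act n n g \<phi>' j) = j" using fun_cong[OF \<phi>'(3), of j] that by (simp add: compose_def)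
      moreover have "act n n g \<phi>' j \<le> n" using simplex_mor_le[OF act_mor[OF fg(2) \<phi>'(1)] that] .
      ultimately show ?thesis by (metis atMost_iff image_eqI)
    qed
    then have "\<phi> = ?id n" using fg(1) by (intro simplex_mor_surj_imp_id) auto
    then show "f \<in> {?id n} \<times> carrier (G n)" using fg by simp
  next
    fix f assume "f \<in> {?id n} \<times> carrier (G n)"
    then obtain g where f: "f = (?id n, g)" and g: "g \<in> carrier (G n)" by auto
    obtain h where "h \<in> carrier (G n)" "h \<otimes>\<^bsub>G n\<^esub> g = \<one>\<^bsub>G n\<^esub>" "g \<otimes>\<^bsub>G n\<^esub> h = \<one>\<^bsub>G n\<^esub>"
      using group.inv_closed[OF group g] group.l_inv[OF group g] group.r_inv[OF group g] by blast
    then have "\<exists>f'\<in>mor C n n. cmp C n n n f f' = idt C n \<and> cmp C n n n f' f = idt C n"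
      using f g by (intro bexI[of _ "(?id n, h)"]) simp_all
    moreover have "f \<in> mor C n n" using f g by simp
    ultimately show "f \<in> carrier (aut_group C n)" unfolding aut_group_def by simp
  qed
  have "crossed_simplicial_group C G \<iota> \<theta>"
  proof (intro crossed_simplicial_group.intro crossed_simplicial_group_axioms.intro C.ncategory_axioms)
    show "group (G n)" for n by (rule group)
    show "\<theta> n \<in> iso (opposite_group (G n)) (aut_group C n)" for n
    proof -
      have "\<theta> n \<in> hom (opposite_group (G n)) (aut_group C n)"
        by (rule homI) (simp_all add: aut, simp_all add: aut_group_def opposite_group_def \<theta>_def)
      moreover have "bij_betw (\<theta> n) (carrier (opposite_group (G n))) (carrier (aut_group C n))"
        unfolding aut by (auto simp: bij_betw_def inj_on_def \<theta>_def opposite_group_def)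
      ultimately show ?thesis by (simp add: iso_def)
    qed
    show "inj_on (\<iota> m n) (mor simplex_cat m n)" for m n by (simp add: inj_on_def \<iota>_def)
    \<comment> \<open>The composite of \<open>\<iota> m n \<phi>\<close> and
      \<open>\<theta> m g\<close> is the pair \<open>(\<phi>, g)\<close> itself.\<close>
    show "\<exists>!p. p \<in> mor simplex_cat m n \<times> carrier (G m) \<and> f = cmp C m m n (\<iota> m n (fst p)) (\<theta> m (snd p))"
      if "f \<in> mor C m n" for f m n
      using that by (intro ex1I[of _ f]) (auto simp: \<iota>_def \<theta>_def)
  qed (auto simp: \<iota>_def)
  \<comment> \<open>Both sides of the exchange relation evaluate to
    \<open>(act m n g \<phi>, pull m n \<phi> g)\<close>.\<close>
  then show ?thesis
    unfolding defines_crossed_simplicial_group_def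
    by (intro exI[of _ C] exI[of _ \<iota>] exI[of _ \<theta>])
      (auto simp: \<iota>_def \<theta>_def id_right[OF act_mor])
qed

section \<open>The twisted construction\<close>

lemma wreath_simps:
  "carrier (wreath G n) = ({..n} \<rightarrow>\<^sub>E carrier G) \<times> {\<gamma>. \<gamma> permutes {..n}}"
  "(g, \<gamma>) \<otimes>\<^bsub>wreath G n\<^esub> (h, \<delta>) = ((\<lambda>i\<in>{..n}. g i \<otimes>\<^bsub>G\<^esub> h (inv' \<gamma> i)), \<gamma> \<circ> \<delta>)"
  "\<one>\<^bsub>wreath G n\<^esub> = (unit_tuple G n, id)"
  by (simp_all add: wreath_def)

lemma wreath_group:
  fixes G :: "'a monoid" (structure)
  assumes "group G"
  shows "group (wreath G n)"
proof (rule groupI)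
  interpret group G by fact
  fix x y z
  assume "x \<in> carrier (wreath G n)" "y \<in> carrier (wreath G n)" "z \<in> carrier (wreath G n)"
  then obtain g \<gamma> h \<delta> k \<epsilon> where xyz: "x = (g, \<gamma>)" "y = (h, \<delta>)" "z = (k, \<epsilon>)"
    and \<gamma>: "\<gamma> permutes {..n}" and \<delta>: "\<delta> permutes {..n}" and \<epsilon>: "\<epsilon> permutes {..n}"
    and ghk: "g \<in> {..n} \<rightarrow>\<^sub>E carrier G" "h \<in> {..n} \<rightarrow>\<^sub>E carrier G" "k \<in> {..n} \<rightarrow>\<^sub>E carrier G"
    by (auto simp: wreath_simps)
  note car = ghk[THEN PiE_mem, unfolded atMost_iff]
  have [simp]: "inv' \<gamma> i \<le> n \<longleftrightarrow> i \<le> n" "inv' \<delta> i \<le> n \<longleftrightarrow> i \<le> n" for i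
    using permutes_in_image[OF permutes_inv[OF \<gamma>], of i] permutes_in_image[OF permutes_inv[OF \<delta>], of i] by auto
  show "x \<otimes>\<^bsub>wreath G n\<^esub> y \<in> carrier (wreath G n)"
    using car permutes_compose[OF \<delta> \<gamma>] by (auto simp: xyz wreath_simps)
  have "inv' (\<gamma> \<circ> \<delta>) = inv' \<delta> \<circ> inv' \<gamma>"
    by (intro o_inv_distrib permutes_bij[OF \<gamma>] permutes_bij[OF \<delta>])
  then show "x \<otimes>\<^bsub>wreath G n\<^esub> y \<otimes>\<^bsub>wreath G n\<^esub> z = x \<otimes>\<^bsub>wreath G n\<^esub> (y \<otimes>\<^bsub>wreath G n\<^esub> z)"
    using car by (auto simp: xyz wreath_simps m_assoc comp_assoc)
next
  interpret group G by fact
  show "\<one>\<^bsub>wreath G n\<^esub> \<in> carrier (wreath G n)"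
    by (auto simp: wreath_simps unit_tuple_def permutes_id)
next
  interpret group G by fact
  fix x assume "x \<in> carrier (wreath G n)"
  then obtain g \<gamma> where x: "x = (g, \<gamma>)" and \<gamma>: "\<gamma> permutes {..n}" and g: "g \<in> {..n} \<rightarrow>\<^sub>E carrier G"
    by (auto simp: wreath_simps)
  have "(\<lambda>i\<in>{..n}. \<one> \<otimes> g i) = g"
    using g by (intro extensionalityI[of _ "{..n}"]) (auto simp: PiE_iff)
  then show "\<one>\<^bsub>wreath G n\<^esub> \<otimes>\<^bsub>wreath G n\<^esub> x = x"
    by (simp add: x wreath_simps unit_tuple_def inv_id cong: restrict_cong)
  have "\<gamma> i \<le> n" if "i \<le> n" for i using permutes_in_image[OF \<gamma>, of i] that by simp
  \<comment> \<open>Multiplying on the left by \<open>inv' \<gamma>\<close> moves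
    \<open>g (\<gamma> i)\<close> to place \<open>i\<close>, hence the index shift in the inverse
    tuple.\<close>
  then have "((\<lambda>i\<in>{..n}. inv g (\<gamma> i)), inv' \<gamma>) \<otimes>\<^bsub>wreath G n\<^esub> x = \<one>\<^bsub>wreath G n\<^esub>"
    using g by (auto simp: x wreath_simps unit_tuple_def PiE_iff permutes_inv_inv[OF \<gamma>] permutes_inv_o[OF \<gamma>])
  moreover have "((\<lambda>i\<in>{..n}. inv g (\<gamma> i)), inv' \<gamma>) \<in> carrier (wreath G n)"
    using g permutes_inv[OF \<gamma>] \<open>\<And>i. i \<le> n \<Longrightarrow> \<gamma> i \<le> n\<close> by (auto simp: wreath_simps PiE_iff)
  ultimately show "\<exists>y\<in>carrier (wreath G n). y \<otimes>\<^bsub>wreath G n\<^esub> x = \<one>\<^bsub>wreath G n\<^esub>" by blast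
qed

text \<open>A closed form for all \<open>\<phi>\<close> and all group elements at once: entries are
  repeated along \<open>\<phi>\<close>, and the permutation is the signed lift in which parity other
  than \<open>1\<close> counts as odd.\<close>

definition twisted_pull ::
  "('a \<Rightarrow> int) \<Rightarrow> nat \<Rightarrow> nat \<Rightarrow> (nat \<Rightarrow> nat) \<Rightarrow> (nat \<Rightarrow> 'a) \<times> (nat \<Rightarrow> nat) \<Rightarrow> (nat \<Rightarrow> 'a) \<times> (nat \<Rightarrow> nat)"
  where
  "twisted_pull par m n \<phi> x =
    ((\<lambda>i\<in>{..m}. fst x (\<phi> i)), lift_perm m n (\<lambda>j. par (fst x j) \<noteq> 1) (snd x) \<phi>)"

context group_with_parity
begin

lemma par_one: "par \<one> = 1"
proof -
  have "par \<one> * par \<one> = par \<one>" using hom_mult[OF par_hom, of \<one> \<one>] by (simp add: sign_img_def)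
  moreover have "par \<one> \<noteq> 0" using hom_in_carrier[OF par_hom, of \<one>] by (auto simp: sign_img_def)
  ultimately show ?thesis by simp
qed

text \<open>Oddness is additive modulo 2, in the exclusive-or form that
  \<open>signed_lift_mult\<close> produces.\<close>

lemma par_mult_neq_1:
  assumes "g \<in> carrier G" "h \<in> carrier G"
  shows "par (g \<otimes> h) \<noteq> 1 \<longleftrightarrow> (par g \<noteq> 1) \<noteq> (par h \<noteq> 1)"
  using hom_mult[OF par_hom, of g h] hom_in_carrier[OF par_hom, of g] hom_in_carrier[OF par_hom, of h] assms
  by (auto simp: sign_img_def)

lemma twisted_pull_closed:
  assumes "x \<in> carrier (wreath G n)" "\<phi> \<in> simplex_mor m n"
  shows "twisted_pull par m n \<phi> x \<in> carrier (wreath G m)"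
  using assms signed_liftD(2)[OF signed_lift_lift_perm[OF _ assms(2)]] simplex_mor_le[OF assms(2)]
  by (auto simp: twisted_pull_def wreath_simps PiE_iff)

lemma twisted_act_mor:
  assumes "x \<in> carrier (wreath G n)" "\<phi> \<in> simplex_mor m n"
  shows "twisted_act m n x \<phi> \<in> simplex_mor m n"
  using assms signed_liftD(1)[OF signed_lift_lift_perm[OF _ assms(2)]]
  by (auto simp: twisted_act_def wreath_simps)

lemma signed_lift_twisted:
  assumes "x \<in> carrier (wreath G n)" "\<phi> \<in> simplex_mor m n"
  shows "signed_lift m n (\<lambda>j. par (fst x j) \<noteq> 1) (snd x) \<phi> (twisted_act m n x \<phi>)
    (snd (twisted_pull par m n \<phi> x))"
  using assms signed_lift_lift_perm[OF _ assms(2)]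
  by (auto simp: twisted_act_def twisted_pull_def wreath_simps)

text \<open>By uniqueness, any signed lift that can be exhibited computes the action and the
  pullback together.\<close>

lemma twisted_eqI:
  assumes "x \<in> carrier (wreath G n)" "\<phi> \<in> simplex_mor m n"
    and "signed_lift m n (\<lambda>j. par (fst x j) \<noteq> 1) (snd x) \<phi> \<psi> \<alpha>"
  shows "twisted_act m n x \<phi> = \<psi>" "twisted_pull par m n \<phi> x = ((\<lambda>i\<in>{..m}. fst x (\<phi> i)), \<alpha>)"
proof -
  have "snd x permutes {..n}" using assms(1) by (auto simp: wreath_simps)
  then show "twisted_act m n x \<phi> = \<psi>" "twisted_pull par m n \<phi> x = ((\<lambda>i\<in>{..m}. fst x (\<phi> i)), \<alpha>)"
    using sym_act_eq[OF _ assms(2,3)] lift_perm_eq[OF _ assms(2,3)]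
    by (simp_all add: twisted_act_def twisted_pull_def)
qed

text \<open>One composite lift from \<open>signed_lift_compose\<close> yields both
  identities.\<close>

lemma twisted_compose:
  assumes x: "x \<in> carrier (wreath G n)" and \<phi>: "\<phi> \<in> simplex_mor m n" and \<chi>: "\<chi> \<in> simplex_mor l m"
  shows "twisted_act l n x (compose {..l} \<phi> \<chi>) =
      compose {..l} (twisted_act m n x \<phi>) (twisted_act l m (twisted_pull par m n \<phi> x) \<chi>)"
    and "twisted_pull par l n (compose {..l} \<phi> \<chi>) x = twisted_pull par l m \<chi> (twisted_pull par m n \<phi> x)"
proof -
  define y where "y = twisted_pull par m n \<phi> x"
  have y: "y \<in> carrier (wreath G m)" unfolding y_def by (rule twisted_pull_closed[OF x \<phi>])
  have fst_y: "fst y i = fst x (\<phi> i)" if "i \<le> m" for i using that by (simp add: y_def twisted_pull_def)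
  \<comment> \<open>The pulled-back tuple has at \<open>i\<close> the sign of \<open>x\<close> at
    \<open>\<phi> i\<close>, but only for \<open>i \<le> m\<close>.\<close>
  have "signed_lift l m (\<lambda>i. par (fst x (\<phi> i)) \<noteq> 1) (snd y) \<chi> (twisted_act l m y \<chi>)
      (snd (twisted_pull par l m \<chi> y))"
    by (rule signed_lift_cong[OF _ _ signed_lift_twisted[OF y \<chi>]])
      (use y in \<open>auto simp: fst_y wreath_simps\<close>)
  from signed_lift_compose[OF signed_lift_twisted[OF x \<phi>], folded y_def, OF this \<chi>]
  have "signed_lift l n (\<lambda>j. par (fst x j) \<noteq> 1) (snd x) (compose {..l} \<phi> \<chi>)
      (compose {..l} (twisted_act m n x \<phi>) (twisted_act l m y \<chi>)) (snd (twisted_pull par l m \<chi> y))" .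
  note * = twisted_eqI[OF x simplex_mor_compose[OF \<phi> \<chi>] this]
  show "twisted_act l n x (compose {..l} \<phi> \<chi>) =
      compose {..l} (twisted_act m n x \<phi>) (twisted_act l m (twisted_pull par m n \<phi> x) \<chi>)"
    using *(1) by (simp add: y_def)
  have "(\<lambda>i\<in>{..l}. fst x (compose {..l} \<phi> \<chi> i)) = (\<lambda>i\<in>{..l}. fst y (\<chi> i))"
    using simplex_mor_le[OF \<chi>] by (auto simp: fst_y compose_def)
  moreover have "twisted_pull par l m \<chi> y =
      ((\<lambda>i\<in>{..l}. fst y (\<chi> i)), snd (twisted_pull par l m \<chi> y))" by (simp add: twisted_pull_def)
  ultimately show "twisted_pull par l n (compose {..l} \<phi> \<chi>) x =
      twisted_pull par l m \<chi> (twisted_pull par m n \<phi> x)"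
    using *(2) unfolding y_def by metis
qed

text \<open>Both identities come from the product lift of \<open>signed_lift_mult\<close>, as parity
  is multiplicative; the tuples are compared separately.\<close>

lemma twisted_mult:
  assumes x: "x \<in> carrier (wreath G n)" and y: "y \<in> carrier (wreath G n)" and \<phi>: "\<phi> \<in> simplex_mor m n"
  shows "twisted_act m n (x \<otimes>\<^bsub>wreath G n\<^esub> y) \<phi> = twisted_act m n y (twisted_act m n x \<phi>)"
    and "twisted_pull par m n \<phi> (x \<otimes>\<^bsub>wreath G n\<^esub> y) =
      twisted_pull par m n \<phi> x \<otimes>\<^bsub>wreath G m\<^esub> twisted_pull par m n (twisted_act m n x \<phi>) y"
proof -
  define \<psi> where "\<psi> = twisted_act m n x \<phi>"
  obtain g \<gamma> h \<delta> where xy: "x = (g, \<gamma>)" "y = (h, \<delta>)" and \<gamma>: "\<gamma> permutes {..n}"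
    and gh: "g \<in> {..n} \<rightarrow>\<^sub>E carrier G" "h \<in> {..n} \<rightarrow>\<^sub>E carrier G"
    using x y by (auto simp: wreath_simps)
  note car = gh[THEN PiE_mem, unfolded atMost_iff]
  have \<psi>: "\<psi> \<in> simplex_mor m n" unfolding \<psi>_def by (rule twisted_act_mor[OF x \<phi>])
  have mult: "x \<otimes>\<^bsub>wreath G n\<^esub> y \<in> carrier (wreath G n)"
    using group.is_monoid[OF wreath_group[OF group_axioms]] x y by (rule monoid.m_closed)
  then have perm: "\<gamma> \<circ> \<delta> permutes {..n}" by (simp add: xy wreath_simps)
  have inv_le: "inv' \<gamma> i \<le> n" if "i \<le> n" for i
    using permutes_in_image[OF permutes_inv[OF \<gamma>], of i] that by auto
  define \<alpha> where "\<alpha> = snd (twisted_pull par m n \<phi> x)"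
  define \<beta> where "\<beta> = snd (twisted_pull par m n \<psi> y)"
  note lift = signed_lift_twisted[OF x \<phi>, folded \<psi>_def \<alpha>_def, unfolded xy fst_conv snd_conv]
  have "signed_lift m n (\<lambda>j. (par (g j) \<noteq> 1) \<noteq> (par (h (inv' \<gamma> j)) \<noteq> 1)) (\<gamma> \<circ> \<delta>) \<phi>
      (twisted_act m n y \<psi>) (\<alpha> \<circ> \<beta>)"
    using signed_lift_mult[OF \<gamma> lift] signed_lift_twisted[OF y \<psi>] by (simp add: xy \<beta>_def)
  then have "signed_lift m n (\<lambda>j. par (fst (x \<otimes>\<^bsub>wreath G n\<^esub> y) j) \<noteq> 1) (snd (x \<otimes>\<^bsub>wreath G n\<^esub> y)) \<phi>
      (twisted_act m n y \<psi>) (\<alpha> \<circ> \<beta>)"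
    unfolding xy wreath_simps fst_conv snd_conv
    by (rule signed_lift_cong[OF perm, rotated]) (use car inv_le par_mult_neq_1 in auto)
  note * = twisted_eqI[OF mult \<phi> this]
  show "twisted_act m n (x \<otimes>\<^bsub>wreath G n\<^esub> y) \<phi> = twisted_act m n y (twisted_act m n x \<phi>)"
    using *(1) by (simp add: \<psi>_def)
  \<comment> \<open>Pulling back the product reads \<open>h\<close> at
    \<open>inv' \<gamma> (\<phi> i)\<close>, multiplying the pullbacks reads it at
    \<open>\<psi> (inv' \<alpha> i)\<close>. The lift equation identifies the two indices.\<close>
  have "\<psi> (inv' \<alpha> i) = inv' \<gamma> (\<phi> i)" "inv' \<alpha> i \<le> m" if "i \<le> m" for i
  proof -
    note D = signed_liftD[OF lift]
    show le: "inv' \<alpha> i \<le> m" using permutes_in_image[OF permutes_inv[OF D(2)], of i] that by auto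
    have "\<gamma> (\<psi> (inv' \<alpha> i)) = \<phi> i" using D(3)[OF le] by (simp add: permutes_inverses[OF D(2)])
    then show "\<psi> (inv' \<alpha> i) = inv' \<gamma> (\<phi> i)" by (metis permutes_inverses(2)[OF \<gamma>])
  qed
  then have "(\<lambda>i\<in>{..m}. fst (x \<otimes>\<^bsub>wreath G n\<^esub> y) (\<phi> i)) =
      (\<lambda>i\<in>{..m}. g (\<phi> i) \<otimes> (\<lambda>i\<in>{..m}. h (\<psi> i)) (inv' \<alpha> i))"
    using simplex_mor_le[OF \<phi>] by (auto simp: xy wreath_simps)
  moreover have "twisted_pull par m n \<phi> x = ((\<lambda>i\<in>{..m}. g (\<phi> i)), \<alpha>)"
    "twisted_pull par m n \<psi> y = ((\<lambda>i\<in>{..m}. h (\<psi> i)), \<beta>)"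
    by (simp_all add: twisted_pull_def xy \<alpha>_def \<beta>_def)
  ultimately show "twisted_pull par m n \<phi> (x \<otimes>\<^bsub>wreath G n\<^esub> y) =
      twisted_pull par m n \<phi> x \<otimes>\<^bsub>wreath G m\<^esub> twisted_pull par m n (twisted_act m n x \<phi>) y"
    using *(2) by (auto simp: wreath_simps simp flip: \<psi>_def)
qed

lemma unit_tuple_closed: "unit_tuple G n \<in> {..n} \<rightarrow>\<^sub>E carrier G"
  by (simp add: unit_tuple_def)

lemma twisted_pull_unit:
  assumes \<gamma>: "\<gamma> permutes {..n}" and \<phi>: "\<phi> \<in> simplex_mor m n"
  shows "twisted_pull par m n \<phi> (unit_tuple G n, \<gamma>) = (unit_tuple G m, sym_pull m n \<phi> \<gamma>)"
proof -
  have "lift_perm m n (\<lambda>j. par (unit_tuple G n j) \<noteq> 1) \<gamma> \<phi> = lift_perm m n (\<lambda>_. False) \<gamma> \<phi>"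
    by (rule lift_perm_cong[OF \<gamma> \<phi>]) (simp add: unit_tuple_def par_one)
  moreover have "(\<lambda>i\<in>{..m}. unit_tuple G n (\<phi> i)) = unit_tuple G m"
    using simplex_mor_le[OF \<phi>] by (auto simp: unit_tuple_def)
  ultimately show ?thesis by (simp add: twisted_pull_def lift_perm_False[OF \<gamma> \<phi>])
qed

text \<open>The multiplication rule for \<open>(g, id)\<close> and
  \<open>(unit_tuple G n, \<gamma>)\<close>, where \<open>(g, id)\<close> acts trivially on
  \<open>\<phi>\<close>.\<close>

lemma twisted_pull_decompose:
  assumes g: "g \<in> {..n} \<rightarrow>\<^sub>E carrier G" and \<gamma>: "\<gamma> permutes {..n}" and \<phi>: "\<phi> \<in> simplex_mor m n"
  shows "twisted_pull par m n \<phi> (g, \<gamma>) =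
    twisted_pull par m n \<phi> (g, id) \<otimes>\<^bsub>wreath G m\<^esub> twisted_pull par m n \<phi> (unit_tuple G n, \<gamma>)"
proof -
  have car: "(g, id) \<in> carrier (wreath G n)" "(unit_tuple G n, \<gamma>) \<in> carrier (wreath G n)"
    using g \<gamma> unit_tuple_closed by (auto simp: wreath_simps permutes_id)
  have "(\<lambda>i\<in>{..n}. g i \<otimes> unit_tuple G n i) = g"
    using g by (intro extensionalityI[of _ "{..n}"]) (auto simp: unit_tuple_def PiE_iff)
  then have "(g, \<gamma>) = (g, id) \<otimes>\<^bsub>wreath G n\<^esub> (unit_tuple G n, \<gamma>)"
    by (simp add: wreath_simps inv_id)
  moreover have "twisted_act m n (g, id) \<phi> = \<phi>"
    using signed_lift_id_left[OF _ \<phi>] signed_lift_twisted[OF car(1) \<phi>] by simp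
  ultimately show ?thesis using twisted_mult(2)[OF car \<phi>] by simp
qed

section \<open>Existence and uniqueness of the construction\<close>

lemma twisted_symmetric_construction_twisted_pull:
  "twisted_symmetric_construction G par (twisted_pull par)"
proof -
  have car: "(g, id) \<in> carrier (wreath G n)" if "g \<in> {..n} \<rightarrow>\<^sub>E carrier G" for g n
    using that by (simp add: wreath_simps permutes_id)
  have face: "twisted_pull par n (Suc n) (face n i) (g, id) = ((\<lambda>k\<in>{..n}. if k < i then g k else g (Suc k)), id)"
    if "i \<le> Suc n" "g \<in> {..Suc n} \<rightarrow>\<^sub>E carrier G" for n i g
    using twisted_eqI(2)[OF car face_mor, OF that(2,1), of "face n i" id] signed_lift_face[OF that(1)]
    by (auto simp: face_def)
  have degen: "twisted_pull par (Suc n) n (degen n i) (g, id) =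
      ((\<lambda>k\<in>{..Suc n}. if k \<le> i then g k else g (k - 1)), if par (g i) = 1 then id else transpose i (Suc i))"
    if "i \<le> n" "g \<in> {..n} \<rightarrow>\<^sub>E carrier G" for n i g
    using twisted_eqI(2)[OF car degen_mor, OF that(2,1), of "degen n i"]
      signed_lift_degen[OF that(1), of "\<lambda>j. par (g j) \<noteq> 1"]
    by (auto simp: degen_def)
  have mor: "mor simplex_cat = simplex_mor" and cmp: "cmp simplex_cat l m n = compose {..l}" for l m n
    by (simp_all add: simplex_cat_def)
  show ?thesis
    unfolding twisted_symmetric_construction_def mor cmp
  proof (intro conjI allI ballI impI Pi_I)
    fix m n \<phi> x assume "\<phi> \<in> simplex_mor m n" "x \<in> carrier (wreath G n)"
    then show "twisted_pull par m n \<phi> x \<in> carrier (wreath G m)" by (intro twisted_pull_closed)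
  next
    fix l m n \<phi> \<psi> g
    assume "\<phi> \<in> simplex_mor m n" "\<psi> \<in> simplex_mor l m" "g \<in> {..n} \<rightarrow>\<^sub>E carrier G"
    then show "twisted_pull par l n (compose {..l} \<phi> \<psi>) (g, id) =
        twisted_pull par l m \<psi> (twisted_pull par m n \<phi> (g, id))"
      using twisted_compose(2)[OF car] by blast
  qed (rule twisted_pull_unit face degen twisted_pull_decompose; assumption)+
qed

text \<open>The values on generators propagate by contravariance to all \<open>\<phi>\<close> on
  elements \<open>(g, id)\<close>, and \<open>full\<close> extends agreement from these to the whole
  wreath product.\<close>

lemma twisted_symmetric_construction_unique:
  assumes Q: "twisted_symmetric_construction G par Q"
    and \<phi>: "\<phi> \<in> simplex_mor m n" and x: "x \<in> carrier (wreath G n)"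
  shows "Q m n \<phi> x = twisted_pull par m n \<phi> x"
proof -
  let ?P = "twisted_pull par"
  note P = twisted_symmetric_construction_twisted_pull
  have mor: "mor simplex_cat = simplex_mor" and cmp: "cmp simplex_cat l m n = compose {..l}" for l m n
    by (simp_all add: simplex_cat_def)
  note defs = twisted_symmetric_construction_def mor cmp
  have Q_compose: "\<forall>l m n. \<forall>\<phi>\<in>simplex_mor m n. \<forall>\<psi>\<in>simplex_mor l m. \<forall>g\<in>{..n} \<rightarrow>\<^sub>E carrier G.
      Q l n (compose {..l} \<phi> \<psi>) (g, id) = Q l m \<psi> (Q m n \<phi> (g, id))"
    using Q unfolding defs by (elim conjE)
  have full: "Q m n \<phi> x = ?P m n \<phi> x"
    if \<phi>: "\<phi> \<in> simplex_mor m n" and "x \<in> carrier (wreath G n)"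
      and id: "\<And>g. g \<in> {..n} \<rightarrow>\<^sub>E carrier G \<Longrightarrow> Q m n \<phi> (g, id) = ?P m n \<phi> (g, id)" for m n \<phi> x
  proof -
    obtain g \<gamma> where x: "x = (g, \<gamma>)" "g \<in> {..n} \<rightarrow>\<^sub>E carrier G" "\<gamma> permutes {..n}"
      using \<open>x \<in> _\<close> by (auto simp: wreath_simps)
    have "Q m n \<phi> x = Q m n \<phi> (g, id) \<otimes>\<^bsub>wreath G m\<^esub> Q m n \<phi> (unit_tuple G n, \<gamma>)"
      using Q x \<phi> unfolding defs by blast
    also have "Q m n \<phi> (unit_tuple G n, \<gamma>) = ?P m n \<phi> (unit_tuple G n, \<gamma>)"
      using Q x \<phi> by (simp add: defs twisted_pull_unit)
    finally show ?thesis
      by (simp only: x(1) id[OF x(2)] twisted_pull_decompose[OF x(2,3) \<phi>])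
  qed
  \<comment> \<open>The claim is proved for every \<open>x\<close>, since pulling
    \<open>(g, id)\<close> back along \<open>\<phi>\<close> may produce a nontrivial permutation
    before \<open>\<psi>\<close> is applied.\<close>
  show ?thesis using \<phi> x
  proof (induction \<phi> arbitrary: x rule: simplex_generators_induct)
    case (face n i)
    show ?case
      by (rule full[OF face_mor[OF face.hyps] face.prems]) (use Q P face.hyps in \<open>simp add: defs\<close>)
  next
    case (degen n i)
    show ?case
      by (rule full[OF degen_mor[OF degen.hyps] degen.prems]) (use Q P degen.hyps in \<open>simp add: defs\<close>)
  next
    case (compose l m n \<phi> \<psi>)
    show ?case
    proof (rule full[OF simplex_mor_compose[OF compose.hyps] compose.prems])
      fix g assume g: "g \<in> {..n} \<rightarrow>\<^sub>E carrier G"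
      then have car: "(g, id) \<in> carrier (wreath G n)" by (simp add: wreath_simps permutes_id)
      have "Q l n (FuncSet.compose {..l} \<phi> \<psi>) (g, id) = Q l m \<psi> (Q m n \<phi> (g, id))"
        by (rule Q_compose[rule_format, OF compose.hyps g])
      also have "\<dots> = ?P l m \<psi> (?P m n \<phi> (g, id))"
        by (simp only: compose.IH(1)[OF car] compose.IH(2)[OF twisted_pull_closed[OF car compose.hyps(1)]])
      also have "\<dots> = ?P l n (FuncSet.compose {..l} \<phi> \<psi>) (g, id)"
        by (simp only: twisted_compose(2)[OF car compose.hyps])
      finally show "Q l n (FuncSet.compose {..l} \<phi> \<psi>) (g, id) = ?P l n (FuncSet.compose {..l} \<phi> \<psi>) (g, id)" .
    qed
  qed
qed

lemma twisted_defines_crossed_simplicial_group: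
  "defines_crossed_simplicial_group (wreath G) twisted_act (twisted_pull par)"
proof (rule defines_crossed_simplicial_groupI)
  show "group (wreath G n)" for n by (rule wreath_group[OF group_axioms])
  have one: "\<one>\<^bsub>wreath G n\<^esub> \<in> carrier (wreath G n)" for n
    using group.is_monoid[OF wreath_group[OF group_axioms]] by (rule monoid.one_closed)
  \<comment> \<open>The unit laws come from evident lifts: \<open>(\<phi>, id)\<close> for the unit
    element, whose entries are even, and below \<open>\<gamma>\<close> itself over the identity map,
    whose fibres are points.\<close>
  have "twisted_act m n \<one>\<^bsub>wreath G n\<^esub> \<phi> = \<phi> \<and> twisted_pull par m n \<phi> \<one>\<^bsub>wreath G n\<^esub> = \<one>\<^bsub>wreath G m\<^esub>"
    if \<phi>: "\<phi> \<in> simplex_mor m n" for m n \<phi>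
  proof -
    have "signed_lift m n (\<lambda>j. par (fst \<one>\<^bsub>wreath G n\<^esub> j) \<noteq> 1) (snd \<one>\<^bsub>wreath G n\<^esub>) \<phi> \<phi> id"
      unfolding wreath_simps fst_conv snd_conv
      by (rule signed_lift_cong[OF permutes_id _ signed_lift_one[OF \<phi>]])
        (simp add: unit_tuple_def par_one)
    moreover have "(\<lambda>i\<in>{..m}. unit_tuple G n (\<phi> i)) = unit_tuple G m"
      using simplex_mor_le[OF \<phi>] by (auto simp: unit_tuple_def)
    ultimately show ?thesis using twisted_eqI[OF one \<phi>] by (auto simp: wreath_simps)
  qed
  then show "twisted_act m n \<one>\<^bsub>wreath G n\<^esub> \<phi> = \<phi>"
    and "twisted_pull par m n \<phi> \<one>\<^bsub>wreath G n\<^esub> = \<one>\<^bsub>wreath G m\<^esub>"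
    if "\<phi> \<in> simplex_mor m n" for m n \<phi> using that by blast+
  show "twisted_act n n x (\<lambda>i\<in>{..n}. i) = (\<lambda>i\<in>{..n}. i)" "twisted_pull par n n (\<lambda>i\<in>{..n}. i) x = x"
    if x: "x \<in> carrier (wreath G n)" for n x
  proof -
    have "snd x permutes {..n}" using x by (auto simp: wreath_simps)
    note * = twisted_eqI[OF x simplex_mor_id signed_lift_id[OF this]]
    show "twisted_act n n x (\<lambda>i\<in>{..n}. i) = (\<lambda>i\<in>{..n}. i)" by (rule *(1))
    have "(\<lambda>i\<in>{..n}. fst x ((\<lambda>i\<in>{..n}. i) i)) = fst x"
      using x by (intro extensionalityI[of _ "{..n}"]) (auto simp: wreath_simps PiE_iff)
    then show "twisted_pull par n n (\<lambda>i\<in>{..n}. i) x = x" using *(2) by simp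
  qed
qed (rule twisted_act_mor twisted_pull_closed twisted_compose twisted_mult; assumption)+

end

text \<open>The construction constrains a family only on morphisms of the simplex category and on
  group elements, while HOL functions are total; uniqueness is therefore agreement on such
  arguments.\<close>

theorem theorem2p9:
  fixes G :: "'a monoid" and par :: "'a \<Rightarrow> int"
  assumes "group_with_parity G par"
  shows "\<exists>P. twisted_symmetric_construction G par P \<and>
    (\<forall>Q. twisted_symmetric_construction G par Q \<longrightarrow>
      (\<forall>m n. \<forall>\<phi> \<in> mor simplex_cat m n. \<forall>x \<in> carrier (wreath G n). Q m n \<phi> x = P m n \<phi> x)) \<and>
    defines_crossed_simplicial_group (wreath G) twisted_act P"
proof -
  interpret group_with_parity G par by (rule assms)
  show ?thesis
    using twisted_symmetric_construction_twisted_pull twisted_symmetric_construction_unique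
      twisted_defines_crossed_simplicial_group
    by (intro exI[of _ "twisted_pull par"]) (simp add: simplex_cat_def)
qed

end
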